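(* Let $n\in\mathbb{N}$ and let $a_i>0$ and $b_i>0$ be real numbers for $1\le i\le n$. (i) For $k=(k_1,\dots,k_n)\in\mathbb{N}_0^n$ define $e_k:[0,+\infty)^n\to\mathbb{R}$ by $$e_k(t_1,\dots,t_n):=e^{-(a_1+k_1b_1)t_1-\dots-(a_n+k_nb_n)t_n}.$$ Then the set $\{e_k : k\in\mathbb{N}_0^n\}$ is total in $L^1([0,+\infty)^n)$. (ii) The sequence $((a_1+k_1b_1,\dots,a_n+k_nb_n))_{(k_1,\dots,k_n)\in\mathbb{N}_0^n}$ is a uniqueness sequence for the multidimensional Laplace transform (in $\mathbb{R}^n$).
   Context: $\mathbb{N}_0=\{0,1,2,\dots\}$, $\mathbb{N}=\{1,2,\dots\}$, $\mathbb{N}_n=\{1,\dots,n\}$. A subset of a Banach space is total if its linear span is dense; $L^1([0,+\infty)^n)$ consists of complex-valued functions. For a locally integrable function $f:[0,+\infty)^n\to\mathbb{C}$ (integrable on every $[0,T]^n$) and $(\lambda_1,\dots,\lambda_n)\in\mathbb{C}^n$, put $I(t_1,\dots,t_n)=\int_0^{t_1}\cdots\int_0^{t_n}e^{-\lambda_1s_1-\dots-\lambda_ns_n}f(s_1,\dots,s_n)\,ds_1\cdots ds_n$. Let $\Omega(f)$ be the set of all $(\lambda_1,\dots,\lambda_n)\in\mathbb{C}^n$ for which the limit $\hat f(\lambda_1,\dots,\lambda_n):=\lim_{t_1\to+\infty;\dots;t_n\to+\infty}I(t_1,\dots,t_n)$ (all $t_i$ tending to $+\infty$ jointly) exists, and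 let $\Omega_b(f)$ be the set of all $(\lambda_1,\dots,\lambda_n)\in\mathbb{C}^n$ for which $\{I(t_1,\dots,t_n): t_1,\dots,t_n\ge 0\}$ is bounded. A sequence $((\lambda_k^1,\dots,\lambda_k^n))_{k\in\mathbb{N}}$ in $\mathbb{C}^n$ is a uniqueness sequence for the multidimensional Laplace transform (in $\mathbb{R}^n$) if the following holds for every locally integrable $f:[0,+\infty)^n\to\mathbb{C}$: if there exist $\omega_1,\dots,\omega_n\in[-\infty,+\infty)$ with $\{\Re\lambda_1>\omega_1\}\times\dots\times\{\Re\lambda_n>\omega_n\}\subseteq\Omega_b(f)\cap\Omega(f)$ and $\omega_j<\Re\lambda_k^j$ for all $k\in\mathbb{N}$, $j\in\mathbb{N}_n$, and if $\hat f(\lambda_k^1,\dots,\lambda_k^n)=0$ for all $k\in\mathbb{N}$, then $f=0$ a.e. This depends only on the set of values of the sequence; a family indexed by a countably infinite set is regarded as a sequence via any enumeration. *)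

theory Defs
  imports "HOL-Analysis.Analysis" "HOL-Library.Function_Algebras"
begin

text \<open>
  On \<open>real ^ 'n\<close> the library order is componentwise.  Hence \<open>{0..}\<close> is the closed
  orthant, \<open>{0..t}\<close> is the box with opposite corners \<open>0\<close> and \<open>t\<close>, and the filter
  \<open>at_top\<close> describes all coordinates tending to infinity jointly.
  A function on the orthant is represented by a total function of which only the values
  on \<open>{0..}\<close> matter.
\<close>

lemma eventually_at_top_vec:
  fixes P :: "real ^ 'n \<Rightarrow> bool"
  shows "eventually P at_top \<longleftrightarrow> (\<exists>T::real. \<forall>t. (\<forall>j. T \<le> t $ j) \<longrightarrow> P t)"
proof -
  have "eventually P at_top \<longleftrightarrow> (\<exists>c. \<forall>t\<ge>c. P t)"
    unfolding at_top_def
  proof (subst eventually_INF_base)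
    fix a b :: "real ^ 'n"
    show "\<exists>x\<in>UNIV. principal {x..} \<le> inf (principal {a..}) (principal {b..})"
      by (intro bexI[of _ "sup a b"]) auto
  qed (auto simp: eventually_principal)
  also have "\<dots> \<longleftrightarrow> (\<exists>T::real. \<forall>t. (\<forall>j. T \<le> t $ j) \<longrightarrow> P t)"
  proof
    assume "\<exists>c. \<forall>t\<ge>c. P t"
    then obtain c where c: "\<And>t. c \<le> t \<Longrightarrow> P t" by blast
    have "P t" if "\<forall>j. Max (range (($) c)) \<le> t $ j" for t
    proof (rule c, unfold less_eq_vec_def, rule allI)
      fix j
      have "c $ j \<le> Max (range (($) c))" by (intro Max_ge) auto
      with that show "c $ j \<le> t $ j" using order_trans by blast
    qed
    then show "\<exists>T::real. \<forall>t. (\<forall>j. T \<le> t $ j) \<longrightarrow> P t" by blast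
  next
    assume "\<exists>T::real. \<forall>t. (\<forall>j. T \<le> t $ j) \<longrightarrow> P t"
    then obtain T where "\<And>t. (\<forall>j. T \<le> t $ j) \<Longrightarrow> P t" by blast
    then show "\<exists>c. \<forall>t\<ge>c. P t"
      by (intro exI[of _ "\<chi> j. T"]) (auto simp: less_eq_vec_def)
  qed
  finally show ?thesis .
qed

lemma at_top_vec_neq_bot: "(at_top :: (real ^ 'n) filter) \<noteq> bot"
proof -
  have "\<exists>t :: real ^ 'n. \<forall>j. T \<le> t $ j" for T :: real
    by (intro exI[of _ "\<chi> j. T"]) auto
  then show ?thesis
    unfolding trivial_limit_def eventually_at_top_vec by blast
qed


subsection \<open>Total subsets of \<open>L\<^sup>1\<close>\<close>

lemma vector_space_complex_fun: "vector_space (\<lambda>(c::complex) f x. c * f x)"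
  by unfold_locales (auto simp: fun_eq_iff algebra_simps)

text \<open>
  Elements of \<open>L\<^sup>1(M)\<close> are represented by integrable functions (equality almost everywhere
  is not factored out); density refers to the \<open>L\<^sup>1\<close>-seminorm, and the span is the
  \<^emph>\<open>complex\<close> linear span.
\<close>

definition total_in_L1 :: "'a measure \<Rightarrow> ('a \<Rightarrow> complex) set \<Rightarrow> bool" where
  "total_in_L1 M E \<longleftrightarrow>
     E \<subseteq> {f. integrable M f} \<and>
     (\<forall>f. integrable M f \<longrightarrow>
       (\<forall>\<epsilon>>0. \<exists>g \<in> module.span (\<lambda>c f x. c * f x) E. (LINT x|M. norm (f x - g x)) < \<epsilon>))"


subsection \<open>The multidimensional Laplace transform\<close>

definition loc_integrable :: "(real ^ 'n \<Rightarrow> complex) \<Rightarrow> bool" where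
  "loc_integrable f \<longleftrightarrow> (\<forall>T::real. set_integrable lebesgue {0..(\<chi> j. T)} f)"

definition laplace_partial ::
    "(real ^ 'n \<Rightarrow> complex) \<Rightarrow> complex ^ 'n \<Rightarrow> real ^ 'n \<Rightarrow> complex" where
  "laplace_partial f l t =
     (LINT s:{0..t}|lebesgue. exp (- (\<Sum>j\<in>UNIV. l $ j * of_real (s $ j))) * f s)"

definition laplace_dom :: "(real ^ 'n \<Rightarrow> complex) \<Rightarrow> (complex ^ 'n) set" where
  "laplace_dom f = {l. \<exists>L. (laplace_partial f l \<longlongrightarrow> L) at_top}"

definition laplace :: "(real ^ 'n \<Rightarrow> complex) \<Rightarrow> complex ^ 'n \<Rightarrow> complex" where
  "laplace f l = Lim at_top (laplace_partial f l)"

definition laplace_bdd_dom :: "(real ^ 'n \<Rightarrow> complex) \<Rightarrow> (complex ^ 'n) set" where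
  "laplace_bdd_dom f = {l. bounded (laplace_partial f l ` {0..})}"

definition uniqueness_sequence :: "(nat \<Rightarrow> complex ^ 'n) \<Rightarrow> bool" where
  "uniqueness_sequence l \<longleftrightarrow>
     (\<forall>f. loc_integrable f \<longrightarrow>
       (\<exists>\<omega> :: 'n \<Rightarrow> ereal.
          (\<forall>j. \<omega> j < \<infinity>) \<and>
          {z. \<forall>j. \<omega> j < ereal (Re (z $ j))} \<subseteq> laplace_bdd_dom f \<inter> laplace_dom f \<and>
          (\<forall>k j. \<omega> j < ereal (Re (l k $ j)))) \<longrightarrow>
       (\<forall>k. laplace f (l k) = 0) \<longrightarrow>
       (AE t in lebesgue_on {0..}. f t = 0))"

text \<open>
  A family indexed by a countably infinite type is turned into a sequence by enumerating the
  index type.  The property depends only on the range of the sequence, so all enumerations are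
  equivalent; for the index type \<open>nat ^ 'n\<close> an enumeration exists by \<open>ex_bij_nat_vec\<close> below.
\<close>

definition uniqueness_family :: "('i \<Rightarrow> complex ^ 'n) \<Rightarrow> bool" where
  "uniqueness_family l \<longleftrightarrow> (\<forall>\<sigma> :: nat \<Rightarrow> 'i. bij \<sigma> \<longrightarrow> uniqueness_sequence (l \<circ> \<sigma>))"

lemma ex_bij_nat_vec: "\<exists>\<sigma> :: nat \<Rightarrow> nat ^ 'n. bij \<sigma>"
proof -
  have "inj (\<lambda>m::nat. (\<chi> j. m) :: nat ^ 'n)"
    by (auto simp: inj_def vec_eq_iff)
  then have "infinite (UNIV :: (nat ^ 'n) set)"
    using finite_subset[OF subset_UNIV] finite_imageD infinite_UNIV_nat by blast
  then show ?thesis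
    using bij_betw_from_nat_into[of "UNIV :: (nat ^ 'n) set"] by auto
qed

end

theory Submission
  imports Defs
begin

text \<open>
  The substitution \<open>x\<^sub>j = exp (- b\<^sub>j s\<^sub>j)\<close> carries the orthant into the unit cube, the exponential
  \<open>e\<^sub>k\<close> to \<open>exp (- a \<bullet> s)\<close> times the monomial \<open>x ^ k\<close>, and the finite measure \<open>exp (- a \<bullet> s) ds\<close> to a
  finite Borel measure \<open>N\<close> on the cube.  Dividing by \<open>exp (- a \<bullet> s)\<close> and substituting is an isometry from \<open>L\<^sup>1\<close> of the
  orthant onto \<open>L\<^sup>1(N)\<close>, so totality of the exponentials (\<open>exponentials_total_in_L1\<close>) is density of
  the polynomials in \<open>L\<^sup>1(N)\<close> (\<open>monomials_total_in_L1\<close>).  The latter follows from the theorem of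
  Stone and Weierstrass: continuous functions are uniform limits of polynomials on the cube, indicators
  of closed sets are dominated limits of continuous functions, and a Dynkin argument reaches all
  Borel sets.

  For uniqueness the transform may converge only conditionally, so \<open>exp (- \<lambda> \<bullet> s) f s\<close> need not
  be integrable and totality cannot be applied to \<open>f\<close> directly.  Instead choose a real \<open>c\<close> with
  \<open>\<omega>\<^sub>j < c\<^sub>j < a\<^sub>j\<close> and let \<open>J u\<close> be the integral of \<open>exp (- c \<bullet> s) f s\<close> over the box \<open>{0..u}\<close>, which
  is bounded in \<open>u\<close> by hypothesis.  An integration by parts without boundary terms
  (\<open>laplace_integral_by_parts\<close>) expresses the partial transform at \<open>c + d\<close> over \<open>{0..t}\<close> as
  \<open>\<Prod>\<^sub>j d\<^sub>j\<close> times the integral of \<open>exp (- d \<bullet> u) J (inf u t)\<close> over the orthant.  Since \<open>J\<close> is bounded,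
  the limit \<open>t \<rightarrow> \<infinity>\<close> may be taken inside.  The zeros of the transform thus say that \<open>J\<close>
  annihilates every exponential with exponent \<open>a - c + k b\<close>.  These are total by the first
  part, and a bounded function annihilating a total set vanishes almost everywhere
  (\<open>bounded_annihilator_of_total_eq_0\<close>).  Finally, a function whose integrals over the boxes \<open>{0..u}\<close>
  vanish is itself zero almost everywhere (\<open>AE_eq_0_if_box_integrals_eq_0\<close>).
\<close>


section \<open>The closure of a span in \<open>L\<^sup>1\<close>\<close>

interpretation cfun: vector_space "\<lambda>(c::complex) (f :: 'a \<Rightarrow> complex) x. c * f x"
  by (rule vector_space_complex_fun)

definition L1_closure :: "'a measure \<Rightarrow> ('a \<Rightarrow> complex) set \<Rightarrow> ('a \<Rightarrow> complex) set" where
  "L1_closure M E = {f. integrable M f \<and>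
     (\<forall>\<epsilon>>0. \<exists>g \<in> cfun.span E. (LINT x|M. norm (f x - g x)) < \<epsilon>)}"

lemma total_in_L1_iff_closure:
  "total_in_L1 M E \<longleftrightarrow> E \<subseteq> {f. integrable M f} \<and> {f. integrable M f} \<subseteq> L1_closure M E"
  unfolding total_in_L1_def L1_closure_def by auto

lemma integrable_span:
  assumes "E \<subseteq> {f. integrable M f}" and "g \<in> cfun.span E"
  shows "integrable M g"
proof -
  have "cfun.subspace {f. integrable M f}"
    by (auto simp: cfun.subspace_def zero_fun_def plus_fun_def)
  then show ?thesis
    using cfun.span_minimal[OF assms(1)] assms(2) by auto
qed

lemma L1_closure_limit:
  assumes E: "E \<subseteq> {f. integrable M f}" and f: "integrable M f"
    and s: "\<And>i::nat. s i \<in> L1_closure M E"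
    and lim: "(\<lambda>i. LINT x|M. norm (f x - s i x)) \<longlonglongrightarrow> 0"
  shows "f \<in> L1_closure M E"
  unfolding L1_closure_def
proof (safe intro!: f)
  fix \<epsilon> :: real assume "\<epsilon> > 0"
  then have "\<forall>\<^sub>F i in sequentially. (LINT x|M. norm (f x - s i x)) < \<epsilon> / 2"
    using lim by (intro order_tendstoD) auto
  then obtain i where i: "(LINT x|M. norm (f x - s i x)) < \<epsilon> / 2"
    by (auto simp: eventually_sequentially)
  have si: "integrable M (s i)" using s by (auto simp: L1_closure_def)
  obtain g where g: "g \<in> cfun.span E" "(LINT x|M. norm (s i x - g x)) < \<epsilon> / 2"
    using s[of i] \<open>\<epsilon> > 0\<close> unfolding L1_closure_def by (auto dest!: spec[of _ "\<epsilon> / 2"])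
  have gi: "integrable M g" by (rule integrable_span[OF E g(1)])
  have "(LINT x|M. norm (f x - g x)) \<le> (LINT x|M. norm (f x - s i x) + norm (s i x - g x))"
  proof (rule integral_mono)
    show "norm (f x - g x) \<le> norm (f x - s i x) + norm (s i x - g x)" for x
      using norm_triangle_ineq[of "f x - s i x" "s i x - g x"] by simp
  qed (use f si gi in auto)
  also have "\<dots> = (LINT x|M. norm (f x - s i x)) + (LINT x|M. norm (s i x - g x))"
    by (intro Bochner_Integration.integral_add integrable_norm Bochner_Integration.integrable_diff f si gi)
  also have "\<dots> < \<epsilon>" using i g(2) by simp
  finally show "\<exists>g\<in>cfun.span E. (LINT x|M. norm (f x - g x)) < \<epsilon>"
    using g(1) by blast
qed

text \<open>
  Dominated convergence turns pointwise limits into \<open>L\<^sup>1\<close>-limits; all later passages from one class of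
  functions to a larger one use the closure in this form.
\<close>
lemma L1_closure_dominated:
  assumes E: "E \<subseteq> {f. integrable M f}" and f: "f \<in> borel_measurable M"
    and s: "\<And>i::nat. s i \<in> L1_closure M E"
    and w: "integrable M w"
    and lim: "AE x in M. (\<lambda>i. s i x) \<longlonglongrightarrow> f x"
    and bound: "\<And>i. AE x in M. norm (s i x) \<le> w x"
  shows "f \<in> L1_closure M E"
proof (rule L1_closure_limit[OF E _ s])
  have si: "integrable M (s i)" for i using s by (auto simp: L1_closure_def)
  have sm: "s i \<in> borel_measurable M" for i using si by auto
  show fi: "integrable M f"
    by (rule integrable_dominated_convergence[OF f sm w lim bound])
  have "(\<lambda>i. LINT x|M. norm (f x - s i x)) \<longlonglongrightarrow> (LINT x|M. 0)"
  proof (rule integral_dominated_convergence)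
    show "integrable M (\<lambda>x. norm (f x) + w x)" using fi w by auto
    show "AE x in M. (\<lambda>i. norm (f x - s i x)) \<longlonglongrightarrow> 0"
      using lim
    proof eventually_elim
      case (elim x)
      have "(\<lambda>i. norm (f x - s i x)) \<longlonglongrightarrow> norm (f x - f x)"
        by (intro tendsto_intros elim)
      then show ?case by simp
    qed
    show "AE x in M. norm (norm (f x - s i x)) \<le> norm (f x) + w x" for i
      using bound[of i]
    proof eventually_elim
      case (elim x)
      then show ?case using norm_triangle_ineq4[of "f x" "s i x"] by simp
    qed
  qed (use f sm in auto)
  then show "(\<lambda>i. LINT x|M. norm (f x - s i x)) \<longlonglongrightarrow> 0" by simp
qed

lemma L1_closure_add:
  assumes E: "E \<subseteq> {f. integrable M f}" and f: "f \<in> L1_closure M E" and g: "g \<in> L1_closure M E"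
  shows "(\<lambda>x. f x + g x) \<in> L1_closure M E"
  unfolding L1_closure_def
proof safe
  have fi: "integrable M f" and gi: "integrable M g" using f g by (auto simp: L1_closure_def)
  then show "integrable M (\<lambda>x. f x + g x)" by auto
  fix \<epsilon> :: real assume "\<epsilon> > 0"
  then obtain f' g' where f': "f' \<in> cfun.span E" "(LINT x|M. norm (f x - f' x)) < \<epsilon> / 2"
    and g': "g' \<in> cfun.span E" "(LINT x|M. norm (g x - g' x)) < \<epsilon> / 2"
    using f g unfolding L1_closure_def by (auto dest!: spec[of _ "\<epsilon> / 2"])
  have f'i: "integrable M f'" and g'i: "integrable M g'"
    by (auto intro: integrable_span[OF E] f'(1) g'(1))
  have "(LINT x|M. norm (f x + g x - (f' + g') x)) \<le> (LINT x|M. norm (f x - f' x) + norm (g x - g' x))"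
  proof (rule integral_mono)
    show "norm (f x + g x - (f' + g') x) \<le> norm (f x - f' x) + norm (g x - g' x)" for x
      using norm_diff_triangle_ineq[of "f x" "g x" "f' x" "g' x"] by simp
  qed (use fi gi f'i g'i in \<open>auto simp: plus_fun_def\<close>)
  also have "\<dots> = (LINT x|M. norm (f x - f' x)) + (LINT x|M. norm (g x - g' x))"
    by (intro Bochner_Integration.integral_add integrable_norm Bochner_Integration.integrable_diff fi gi f'i g'i)
  also have "\<dots> < \<epsilon>" using f' g' by simp
  finally show "\<exists>h\<in>cfun.span E. (LINT x|M. norm (f x + g x - h x)) < \<epsilon>"
    using cfun.span_add[OF f'(1) g'(1)] by blast
qed

lemma L1_closure_scale:
  assumes f: "f \<in> L1_closure M E"
  shows "(\<lambda>x. c * f x) \<in> L1_closure M E"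
proof (cases "c = 0")
  case True
  then show ?thesis using cfun.span_zero[of E] by (force simp: L1_closure_def zero_fun_def)
next
  case False
  show ?thesis
    unfolding L1_closure_def
  proof safe
    show "integrable M (\<lambda>x. c * f x)" using f by (auto simp: L1_closure_def)
    fix \<epsilon> :: real assume "\<epsilon> > 0"
    then obtain g where g: "g \<in> cfun.span E" "(LINT x|M. norm (f x - g x)) < \<epsilon> / norm c"
      using f False unfolding L1_closure_def by (auto dest!: spec[of _ "\<epsilon> / norm c"])
    have "(LINT x|M. norm (c * f x - c * g x)) = norm c * (LINT x|M. norm (f x - g x))"
      by (simp add: norm_mult flip: right_diff_distrib)
    also have "\<dots> < \<epsilon>" using g(2) False by (simp add: field_simps)
    finally show "\<exists>h\<in>cfun.span E. (LINT x|M. norm (c * f x - h x)) < \<epsilon>"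
      using cfun.span_scale[OF g(1)] by (rule bexI)
  qed
qed

text \<open>
  Integrable functions are dominated limits of simple functions, so only indicators have to be
  approximated.
\<close>
lemma total_in_L1_if_indicators:
  assumes E: "E \<subseteq> {f. integrable M f}"
    and ind: "\<And>A. A \<in> sets M \<Longrightarrow> emeasure M A < \<infinity> \<Longrightarrow>
                (\<lambda>x. complex_of_real (indicator A x)) \<in> L1_closure M E"
  shows "total_in_L1 M E"
  unfolding total_in_L1_iff_closure
proof (safe dest!: subsetD[OF E])
  fix f :: "'a \<Rightarrow> complex" assume "integrable M f"
  then show "f \<in> L1_closure M E"
  proof induction
    case (base A c)
    have "(\<lambda>x. indicator A x *\<^sub>R c) = (\<lambda>x. c * complex_of_real (indicator A x))"
      by (auto simp: scaleR_conv_of_real)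
    then show ?case using L1_closure_scale[OF ind[OF base]] by simp
  next
    case (add f g)
    then show ?case by (intro L1_closure_add[OF E])
  next
    case (lim f s)
    show ?case
      by (rule L1_closure_dominated[OF E, where s = s and w = "\<lambda>x. 2 * norm (f x)"])
         (use lim in \<open>auto intro!: AE_I2\<close>)
  qed
qed

section \<open>Density of the polynomials for a compactly supported measure\<close>

definition monomials :: "(real ^ 'n \<Rightarrow> complex) set" where
  "monomials = range (\<lambda>(k :: nat ^ 'n) x. complex_of_real (\<Prod>j\<in>UNIV. (x $ j) ^ (k $ j)))"

text \<open>
  Products of monomials are monomials, which makes their span an algebra; this is the
  multiplication step in the induction over polynomial functions.
\<close>
lemma span_monomials_mult:
  assumes g: "g \<in> cfun.span monomials" and h: "h \<in> cfun.span monomials"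
  shows "(\<lambda>x. g x * h x) \<in> cfun.span monomials"
proof -
  have mm: "(\<lambda>x. p x * q x) \<in> monomials" if p: "p \<in> monomials" and q: "q \<in> monomials" for p q :: "real^'n \<Rightarrow> complex"
  proof -
    obtain k where "p = (\<lambda>x. complex_of_real (\<Prod>j\<in>UNIV. (x $ j) ^ (k $ j)))"
      using p unfolding monomials_def by (rule rangeE)
    moreover obtain l where "q = (\<lambda>x. complex_of_real (\<Prod>j\<in>UNIV. (x $ j) ^ (l $ j)))"
      using q unfolding monomials_def by (rule rangeE)
    ultimately have "(\<lambda>x. p x * q x) = (\<lambda>x. complex_of_real (\<Prod>j\<in>UNIV. (x $ j) ^ ((k + l) $ j)))"
      by (auto simp: power_add prod.distrib)
    then show ?thesis unfolding monomials_def by (rule range_eqI)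
  qed
  have pm: "(\<lambda>x. p x * h x) \<in> cfun.span monomials" if p: "p \<in> monomials" for p
    using h
  proof (induction rule: cfun.span_induct_alt)
    case base
    show ?case using cfun.span_zero by (simp add: zero_fun_def)
  next
    case (step c q r)
    have "(\<lambda>x. c * (p x * q x)) + (\<lambda>x. p x * r x) \<in> cfun.span monomials"
      using step mm[OF p] by (intro cfun.span_add[OF cfun.span_scale[OF cfun.span_base]]) auto
    then show ?case by (simp add: plus_fun_def algebra_simps)
  qed
  show ?thesis
    using g
  proof (induction rule: cfun.span_induct_alt)
    case base
    show ?case using cfun.span_zero by (simp add: zero_fun_def)
  next
    case (step c q r)
    have "(\<lambda>x. c * (q x * h x)) + (\<lambda>x. r x * h x) \<in> cfun.span monomials"
      using step pm by (intro cfun.span_add cfun.span_scale) auto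
    then show ?case by (simp add: plus_fun_def algebra_simps)
  qed
qed

lemma const_in_span_monomials: "(\<lambda>x. c) \<in> cfun.span monomials"
proof -
  have "(\<lambda>x. 1) = (\<lambda>x. complex_of_real (\<Prod>j\<in>UNIV. (x $ j) ^ ((0 :: nat ^ 'n) $ j)))"
    by auto
  then have "(\<lambda>x :: real^'n. 1) \<in> monomials" unfolding monomials_def by blast
  from cfun.span_scale[OF cfun.span_base[OF this], of c] show ?thesis by simp
qed

lemma real_polynomial_in_span_monomials:
  fixes p :: "real ^ 'n \<Rightarrow> real"
  assumes "real_polynomial_function p"
  shows "(\<lambda>x. complex_of_real (p x)) \<in> cfun.span monomials"
  using assms
proof induction
  case (linear f)
  have sum_fun: "(\<Sum>j\<in>J. h j) = (\<lambda>x. \<Sum>j\<in>J. h j x)"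
    for h :: "'n \<Rightarrow> real^'n \<Rightarrow> complex" and J
    by (induction J rule: infinite_finite_induct) (auto simp: fun_eq_iff)
  have coord: "(\<lambda>x :: real^'n. complex_of_real (x $ j)) \<in> monomials" for j
  proof -
    have "(\<Prod>i\<in>UNIV. (x $ i) ^ ((axis j 1 :: nat ^ 'n) $ i)) = x $ j" for x :: "real^'n"
    proof -
      have "(\<Prod>i\<in>UNIV. (x $ i) ^ ((axis j 1 :: nat ^ 'n) $ i)) = (\<Prod>i\<in>UNIV. if i = j then x $ i else 1)"
        by (intro prod.cong) (auto simp: axis_def)
      then show ?thesis by simp
    qed
    then show ?thesis unfolding monomials_def by (intro image_eqI[of _ _ "axis j 1"]) auto
  qed
  have "complex_of_real (f x) = (\<Sum>j\<in>UNIV. complex_of_real (f (axis j 1)) * complex_of_real (x $ j))" for x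
  proof -
    have "f x = f (\<Sum>j\<in>UNIV. x $ j *\<^sub>R axis j 1)"
      by (metis basis_expansion scalar_mult_eq_scaleR)
    also have "\<dots> = (\<Sum>j\<in>UNIV. x $ j * f (axis j 1))"
      using linear by (simp add: linear_sum linear_scale bounded_linear.linear)
    finally show ?thesis by (simp add: mult.commute)
  qed
  then have "(\<lambda>x. complex_of_real (f x)) = (\<Sum>j\<in>UNIV. (\<lambda>x. complex_of_real (f (axis j 1)) * complex_of_real (x $ j)))"
    unfolding sum_fun by (rule ext)
  also have "\<dots> \<in> cfun.span monomials"
    by (intro cfun.span_sum cfun.span_scale cfun.span_base coord)
  finally show ?case .
next
  case (const c)
  show ?case by (rule const_in_span_monomials)
next
  case (add f g)
  then show ?case using cfun.span_add by (fastforce simp: plus_fun_def)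
next
  case (mult f g)
  then show ?case using span_monomials_mult by fastforce
qed

text \<open>
  On the compact set that carries the measure, polynomials approximate continuous functions uniformly,
  hence in \<open>L\<^sup>1\<close> because the measure is finite.  The closed sets are stable under intersection and
  generate the Borel sets, so it suffices to reach their indicators: the sets whose indicator lies in
  the closure form a Dynkin system.
\<close>
theorem monomials_total_in_L1:
  fixes N :: "(real ^ 'n) measure"
  assumes "finite_measure N" and sets[measurable_cong]: "sets N = sets borel"
    and K: "compact K" and conc: "AE x in N. x \<in> K"
  shows "total_in_L1 N monomials"
proof (rule total_in_L1_if_indicators)
  interpret finite_measure N by fact
  have bounded_integrable: "integrable N f" if "continuous_on UNIV f" for f :: "real^'n \<Rightarrow> complex"
  proof -
    have "compact (f ` K)" using that K by (meson compact_continuous_image continuous_on_subset subset_UNIV)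
    then obtain B where "\<And>x. x \<in> K \<Longrightarrow> norm (f x) \<le> B"
      by (meson bounded_iff compact_imp_bounded image_eqI)
    moreover have "f \<in> borel_measurable N"
      using borel_measurable_continuous_onI[OF that] by measurable
    ultimately show ?thesis
      using conc by (intro integrable_const_bound[of _ B]) auto
  qed
  show E: "monomials \<subseteq> {f. integrable N f}"
    by (auto simp: monomials_def intro!: bounded_integrable continuous_intros)
  have cont: "(\<lambda>x. complex_of_real (\<phi> x)) \<in> L1_closure N monomials" if \<phi>: "continuous_on UNIV \<phi>" for \<phi>
    unfolding L1_closure_def
  proof safe
    show i: "integrable N (\<lambda>x. complex_of_real (\<phi> x))"
      by (intro bounded_integrable continuous_intros \<phi>)
    fix \<epsilon> :: real assume \<epsilon>: "\<epsilon> > 0"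
    define m where "m = measure N (space N)"
    have m: "m \<ge> 0" by (simp add: m_def)
    define d where "d = \<epsilon> / (m + 1)"
    have d: "d > 0" using \<epsilon> m by (simp add: d_def)
    obtain p where p: "real_polynomial_function p" "\<And>x. x \<in> K \<Longrightarrow> \<bar>\<phi> x - p x\<bar> < d"
      using Stone_Weierstrass_real_polynomial_function[OF K continuous_on_subset[OF \<phi> subset_UNIV] d] by blast
    have "(LINT x|N. norm (complex_of_real (\<phi> x) - complex_of_real (p x))) \<le> (LINT x|N. d)"
    proof (rule integral_mono_AE)
      show "integrable N (\<lambda>x. norm (complex_of_real (\<phi> x) - complex_of_real (p x)))"
        by (intro integrable_norm Bochner_Integration.integrable_diff i
            integrable_span[OF E real_polynomial_in_span_monomials[OF p(1)]])
      show "AE x in N. norm (complex_of_real (\<phi> x) - complex_of_real (p x)) \<le> d"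
        using conc
      proof eventually_elim
        case (elim x)
        then show ?case using p(2)[of x] by (simp add: norm_of_real flip: of_real_diff)
      qed
    qed simp
    also have "\<dots> = m * d" by (simp add: m_def)
    also have "\<dots> < \<epsilon>" using \<epsilon> m by (simp add: d_def field_simps)
    finally show "\<exists>g\<in>cfun.span monomials. (LINT x|N. norm (complex_of_real (\<phi> x) - g x)) < \<epsilon>"
      using real_polynomial_in_span_monomials[OF p(1)] by (rule bexI)
  qed
  have closed: "(\<lambda>x. complex_of_real (indicator C x)) \<in> L1_closure N monomials" if C: "closed C" for C
  proof (cases "C = {}")
    case True
    then show ?thesis using cont[of "\<lambda>_. 0"] by simp
  next
    case False
    \<comment> \<open>Cutoffs supported in the \<open>1/m\<close>-neighbourhood of \<open>C\<close>; they decrease to its indicator.\<close>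
    define \<phi> where "\<phi> m x = max 0 (1 - real m * infdist x C)" for m :: nat and x
    show ?thesis
    proof (rule L1_closure_dominated[OF E, where s = "\<lambda>m x. complex_of_real (\<phi> m x)" and w = "\<lambda>_. 1"])
      show "(\<lambda>x. complex_of_real (\<phi> m x)) \<in> L1_closure N monomials" for m
        unfolding \<phi>_def by (intro cont continuous_intros)
      show "AE x in N. (\<lambda>m. complex_of_real (\<phi> m x)) \<longlonglongrightarrow> complex_of_real (indicator C x)"
      proof (intro AE_I2 tendsto_of_real)
        fix x
        show "(\<lambda>m. \<phi> m x) \<longlonglongrightarrow> indicator C x"
        proof (cases "x \<in> C")
          case True
          then show ?thesis by (simp add: \<phi>_def)
        next
          case x: False
          then have pos: "infdist x C > 0"
            using infdist_pos_not_in_closed[OF C False] by auto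
          obtain m0 :: nat where m0: "1 / infdist x C < real m0" using reals_Archimedean2 by blast
          have "\<phi> m x = 0" if "m \<ge> m0" for m
          proof -
            have "1 < real m0 * infdist x C" using m0 pos by (simp add: field_simps)
            also have "\<dots> \<le> real m * infdist x C" using that pos by (intro mult_right_mono) auto
            finally show ?thesis by (simp add: \<phi>_def)
          qed
          then have "\<forall>\<^sub>F m in sequentially. \<phi> m x = 0" by (auto simp: eventually_sequentially)
          then show ?thesis using x by (simp add: tendsto_eventually)
        qed
      qed
      show "AE x in N. norm (complex_of_real (\<phi> m x)) \<le> 1" for m
        by (intro AE_I2) (auto simp: \<phi>_def infdist_nonneg)
      show "(\<lambda>x. complex_of_real (indicator C x)) \<in> borel_measurable N"
        using borel_closed[OF C] by measurable
    qed simp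
  qed
  fix A assume "A \<in> sets N"
  then have A: "A \<in> sigma_sets UNIV (Collect closed)"
    by (simp add: sets borel_eq_closed)
  have int: "Int_stable (Collect closed :: (real^'n) set set)"
    by (auto simp: Int_stable_def)
  have pow: "Collect closed \<subseteq> Pow (UNIV :: (real^'n) set)" by simp
  from int pow A show "(\<lambda>x. complex_of_real (indicator A x)) \<in> L1_closure N monomials"
  proof (induction rule: sigma_sets_induct_disjoint)
    case (basic A)
    then show ?case by (intro closed) simp
  next
    case empty
    show ?case using closed[of "{}"] by simp
  next
    case (compl A)
    have "(\<lambda>x. complex_of_real (indicator UNIV x) + (-1) * complex_of_real (indicator A x)) \<in> L1_closure N monomials"
      by (intro L1_closure_add[OF E] L1_closure_scale closed compl) auto
    also have "(\<lambda>x. complex_of_real (indicator UNIV x) + (-1) * complex_of_real (indicator A x)) =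
        (\<lambda>x. complex_of_real (indicator (UNIV - A) x))"
      by (auto simp: fun_eq_iff indicator_def)
    finally show ?case .
  next
    case (union A)
    have A: "A i \<in> sets borel" for i using union(2) by (auto simp: borel_eq_closed)
    have partial: "(\<lambda>x. \<Sum>i<m. complex_of_real (indicator (A i) x)) \<in> L1_closure N monomials" for m
    proof (induction m)
      case 0
      show ?case using closed[of "{}"] by simp
    next
      case (Suc m)
      then show ?case using L1_closure_add[OF E Suc union(3)[of m]] by simp
    qed
    have sum_eq: "(\<Sum>i<m. complex_of_real (indicator (A i) x)) = complex_of_real (indicator (\<Union>i<m. A i) x)" for m x
    proof -
      have "indicat_real (\<Union>i<m. A i) x = (\<Sum>i<m. indicator (A i) x)"
        using union(1) by (intro indicator_UN_disjoint) (auto simp: disjoint_family_on_def)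
      then show ?thesis by (simp flip: of_real_sum)
    qed
    show ?case
    proof (rule L1_closure_dominated[OF E _ partial, where w = "\<lambda>_. 1"])
      show "(\<lambda>x. complex_of_real (indicator (\<Union>i. A i) x)) \<in> borel_measurable N"
        using A by measurable
      show "AE x in N. (\<lambda>m. \<Sum>i<m. complex_of_real (indicator (A i) x)) \<longlonglongrightarrow> complex_of_real (indicator (\<Union>i. A i) x)"
        unfolding sum_eq by (intro AE_I2 tendsto_of_real LIMSEQ_indicator_UN)
      show "AE x in N. norm (\<Sum>i<m. complex_of_real (indicator (A i) x)) \<le> 1" for m
        unfolding sum_eq by (intro AE_I2) (simp add: indicator_def)
    qed simp
  qed
qed

section \<open>Totality of the exponentials on the orthant\<close>

lemma nn_integral_exp_atLeast:
  fixes d s :: real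
  assumes "d > 0"
  shows "(\<integral>\<^sup>+y. ennreal (exp (- (d * y))) * indicator {s..} y \<partial>lborel) = ennreal (exp (- (d * s)) / d)"
proof -
  have lim: "((\<lambda>y. - exp (- (d * y)) / d) \<longlongrightarrow> 0) at_top"
    using assms by real_asymp
  have "(\<integral>\<^sup>+y. ennreal (exp (- (d * y))) * indicator {s..} y \<partial>lborel) = ennreal (0 - (- exp (- (d * s)) / d))"
    by (rule nn_integral_FTC_atLeast[OF _ _ _ lim])
       (use assms in \<open>auto intro!: derivative_eq_intros\<close>)
  then show ?thesis by simp
qed

text \<open>
  The integrand is a product of functions of one coordinate each.  For \<open>s = 0\<close> the formula yields the
  integrability of exponentials on the orthant; for general \<open>s\<close> it is the kernel of the integration by
  parts below.
\<close>
lemma has_integral_exp_orthant: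
  fixes d s :: "'a :: ordered_euclidean_space"
  assumes d: "\<And>b. b \<in> Basis \<Longrightarrow> d \<bullet> b > 0"
  shows "has_bochner_integral lborel (\<lambda>u. indicator {s..} u * exp (- (d \<bullet> u)))
           (exp (- (d \<bullet> s)) / (\<Prod>b\<in>Basis. d \<bullet> b))"
proof (rule has_bochner_integral_nn_integral)
  have exp_inner: "exp (- (d \<bullet> u)) = (\<Prod>b\<in>Basis. exp (- ((d \<bullet> b) * (u \<bullet> b))))" for u
    by (subst euclidean_inner) (simp add: exp_sum flip: sum_negf)
  have ind: "indicator {s..} u = (\<Prod>b\<in>Basis. indicat_real {s \<bullet> b..} (u \<bullet> b))" for u
    by (auto simp: eucl_le[where 'a='a] indicator_def)
  have "(\<integral>\<^sup>+u. ennreal (indicator {s..} u * exp (- (d \<bullet> u))) \<partial>lborel) =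
     (\<integral>\<^sup>+u. (\<Prod>b\<in>Basis. ennreal (exp (- ((d \<bullet> b) * (u \<bullet> b)))) * indicator {s \<bullet> b..} (u \<bullet> b)) \<partial>lborel)"
    unfolding exp_inner ind
    by (intro nn_integral_cong)
       (simp add: prod_ennreal mult.commute flip: prod.distrib ennreal_indicator ennreal_mult)
  also have "\<dots> = (\<Prod>b\<in>Basis. (\<integral>\<^sup>+y. ennreal (exp (- ((d \<bullet> b) * y))) * indicator {s \<bullet> b..} y \<partial>lborel))"
    by (rule nn_integral_lborel_prod) auto
  also have "\<dots> = (\<Prod>b\<in>Basis. ennreal (exp (- ((d \<bullet> b) * (s \<bullet> b))) / (d \<bullet> b)))"
    by (intro prod.cong refl nn_integral_exp_atLeast d)
  also have "\<dots> = ennreal (exp (- (d \<bullet> s)) / (\<Prod>b\<in>Basis. d \<bullet> b))"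
    using d by (subst prod_ennreal) (auto simp: exp_inner prod_dividef less_imp_le)
  finally show "(\<integral>\<^sup>+u. ennreal (indicator {s..} u * exp (- (d \<bullet> u))) \<partial>lborel) =
      ennreal (exp (- (d \<bullet> s)) / (\<Prod>b\<in>Basis. d \<bullet> b))" .
qed (use d in \<open>auto intro!: divide_nonneg_nonneg prod_nonneg simp: less_imp_le\<close>)

lemma ex_borel_representative:
  fixes f :: "'a :: euclidean_space \<Rightarrow> complex"
  assumes "f \<in> borel_measurable lebesgue"
  shows "\<exists>g\<in>borel_measurable borel. AE x in lborel. f x = g x"
proof -
  have "(\<lambda>x. Re (f x)) \<in> borel_measurable lebesgue" "(\<lambda>x. Im (f x)) \<in> borel_measurable lebesgue"
    using assms by measurable
  from this[THEN completion_ex_borel_measurable_real]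
  obtain u v where u: "u \<in> borel_measurable lborel" "AE x in lborel. Re (f x) = u x"
    and v: "v \<in> borel_measurable lborel" "AE x in lborel. Im (f x) = v x"
    by blast
  show ?thesis
  proof (intro bexI)
    show "AE x in lborel. f x = Complex (u x) (v x)"
      using u(2) v(2) by eventually_elim (simp add: complex_eq_iff)
    have "(\<lambda>x. complex_of_real (u x) + \<i> * complex_of_real (v x)) \<in> borel_measurable borel"
      using u(1) v(1) by measurable
    then show "(\<lambda>x. Complex (u x) (v x)) \<in> borel_measurable borel"
      by (simp add: Complex_eq)
  qed
qed

definition exponentials :: "real ^ 'n \<Rightarrow> real ^ 'n \<Rightarrow> (real ^ 'n \<Rightarrow> complex) set" where
  "exponentials a b = range (\<lambda>(k :: nat ^ 'n) t.
     complex_of_real (exp (- (\<Sum>i\<in>UNIV. (a $ i + real (k $ i) * b $ i) * t $ i))))"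

lemma Basis_vec_pos:
  assumes "\<And>i. d $ i > 0" and "v \<in> Basis"
  shows "d \<bullet> (v :: real ^ 'n) > 0"
  using assms by (auto simp: Basis_vec_def inner_axis)

lemma integrable_exp_orthant:
  fixes d :: "real ^ 'n"
  assumes "\<And>i. d $ i > 0"
  shows "integrable (lebesgue_on {0..}) (\<lambda>t. complex_of_real (exp (- (\<Sum>i\<in>UNIV. d $ i * t $ i))))"
proof -
  have "integrable lborel (\<lambda>u. indicator {0..} u * exp (- (d \<bullet> u)))"
    using has_integral_exp_orthant[of d 0] Basis_vec_pos[of d] assms by (auto simp: has_bochner_integral_iff)
  then have "integrable lborel (\<lambda>u. complex_of_real (indicator {0..} u * exp (- (d \<bullet> u))))"
    by (rule integrable_of_real)
  then show ?thesis
    by (subst integrable_restrict_space)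
       (auto simp: integrable_completion inner_vec_def scaleR_conv_of_real)
qed

text \<open>
  Transport of the density of polynomials along \<open>T s = (exp (- b\<^sub>j s\<^sub>j))\<^sub>j\<close>.  The map is injective with
  the Borel left inverse \<open>R\<close>, so every integrable \<open>F\<close> on the orthant has the form
  \<open>exp (- a \<bullet> s) h (T s)\<close> with \<open>h = (exp (a \<bullet> _) F) \<circ> R\<close>, and approximating \<open>h\<close> by a polynomial \<open>p\<close> in
  the image measure means approximating \<open>F\<close> by \<open>exp (- a \<bullet> s) p (T s)\<close>.
\<close>
theorem exponentials_total_in_L1:
  fixes a b :: "real ^ 'n"
  assumes a: "\<And>i. a $ i > 0" and b: "\<And>i. b $ i > 0"
  shows "total_in_L1 (lebesgue_on {0..}) (exponentials a b)"
  unfolding total_in_L1_def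
proof (intro conjI allI impI)
  show E: "exponentials a b \<subseteq> {f. integrable (lebesgue_on {0..}) f}"
  proof (unfold exponentials_def, safe)
    fix k :: "nat ^ 'n"
    have "(\<chi> i. a $ i + real (k $ i) * b $ i) $ i > 0" for i
      using a[of i] b[of i] by (simp add: add_pos_nonneg)
    from integrable_exp_orthant[OF this]
    show "integrable (lebesgue_on {0..}) (\<lambda>t. complex_of_real (exp (- (\<Sum>i\<in>UNIV. (a $ i + real (k $ i) * b $ i) * t $ i))))"
      by simp
  qed
  fix f :: "real ^ 'n \<Rightarrow> complex" and \<epsilon> :: real
  assume f: "integrable (lebesgue_on {0..}) f" and \<epsilon>: "\<epsilon> > 0"
  define w :: "real ^ 'n \<Rightarrow> real" where "w s = indicator {0..} s * exp (- (a \<bullet> s))" for s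
  define T :: "real ^ 'n \<Rightarrow> real ^ 'n" where "T s = (\<chi> j. exp (- (b $ j * s $ j)))" for s
  define R :: "real ^ 'n \<Rightarrow> real ^ 'n" where "R x = (\<chi> j. - ln (x $ j) / b $ j)" for x
  define N where "N = distr (density lborel (\<lambda>s. ennreal (w s))) borel T"
  have b0: "b $ j \<noteq> 0" for j using b[of j] by simp
  have RT: "R (T s) = s" for s
    using b0 by (simp add: R_def T_def vec_eq_iff)
  have [measurable]: "w \<in> borel_measurable borel"
    unfolding w_def by measurable
  have wnn: "w s \<ge> 0" for s by (simp add: w_def)
  have [measurable]: "T \<in> borel_measurable borel"
    unfolding T_def by (intro borel_measurable_continuous_onI continuous_intros)
  have [measurable]: "R \<in> borel_measurable borel"
    unfolding R_def
  proof (rule borel_measurable_euclidean_space[THEN iffD2], safe)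
    fix v :: "real ^ 'n" assume "v \<in> Basis"
    then obtain j where v: "v = axis j 1" by (auto simp: Basis_vec_def)
    have "(\<lambda>x :: real ^ 'n. x $ j) \<in> borel_measurable borel"
      by (intro borel_measurable_continuous_onI continuous_intros)
    then have "(\<lambda>x :: real ^ 'n. - ln (x $ j) / b $ j) \<in> borel_measurable borel" by measurable
    then show "(\<lambda>x :: real ^ 'n. (\<chi> j. - ln (x $ j) / b $ j) \<bullet> v) \<in> borel_measurable borel"
      by (simp add: v inner_axis)
  qed
  have "integrable lborel w"
    using has_integral_exp_orthant[of a 0] Basis_vec_pos[of a] a
    by (auto simp: has_bochner_integral_iff w_def[abs_def])
  then have "(\<integral>\<^sup>+s. ennreal (w s) \<partial>lborel) < \<infinity>"
    using wnn by (subst (asm) integrable_iff_bounded) auto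
  then have "finite_measure (density lborel (\<lambda>s. ennreal (w s)))"
    by (intro finite_measureI) (simp add: emeasure_density)
  then have fin: "finite_measure N"
    unfolding N_def by (intro finite_measure.finite_measure_distr) auto
  have conc: "AE x in N. x \<in> {0..1}"
    unfolding N_def
  proof (subst AE_distr_iff)
    show "AE s in density lborel (\<lambda>s. ennreal (w s)). T s \<in> {0..1}"
    proof (subst AE_density, simp, intro AE_I2 impI)
      fix s assume "0 < ennreal (w s)"
      then have s: "s \<ge> 0" by (cases "s \<ge> 0") (simp_all add: w_def)
      show "T s \<in> {0..1}"
        using s b by (auto simp: T_def less_eq_vec_def intro!: mult_nonneg_nonneg less_imp_le[OF b])
    qed
  qed auto
  have tot: "total_in_L1 N monomials"
    by (rule monomials_total_in_L1[OF fin _ compact_interval conc]) (simp add: N_def)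
  have "(\<lambda>x. indicator {0..} x *\<^sub>R f x) \<in> borel_measurable lebesgue"
    using f by (auto simp: integrable_restrict_space)
  then obtain F where F[measurable]: "F \<in> borel_measurable borel"
    and fF: "AE x in lborel. indicator {0..} x *\<^sub>R f x = F x"
    using ex_borel_representative by blast
  define h where "h x = exp (a \<bullet> R x) *\<^sub>R F (R x)" for x
  have h[measurable]: "h \<in> borel_measurable borel"
    unfolding h_def by measurable
  have integrable_N: "integrable N q \<longleftrightarrow> integrable lborel (\<lambda>s. w s *\<^sub>R q (T s))"
    if [measurable]: "q \<in> borel_measurable borel" for q :: "real ^ 'n \<Rightarrow> complex"
    unfolding N_def using wnn
    by (subst integrable_distr_eq, simp, simp, subst integrable_density) auto
  have integral_N: "integral\<^sup>L N q = (LINT s|lborel. w s *\<^sub>R q (T s))"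
    if [measurable]: "q \<in> borel_measurable borel" for q :: "real ^ 'n \<Rightarrow> real"
    unfolding N_def using wnn
    by (subst integral_distr, simp, simp, subst integral_density) auto
  have wh: "w s *\<^sub>R h (T s) = indicator {0..} s *\<^sub>R F s" for s
    by (simp add: h_def RT w_def exp_minus)
  have "integrable lebesgue (\<lambda>x. indicator {0..} x *\<^sub>R f x)"
    using f by (simp add: integrable_restrict_space)
  moreover have "AE x in lebesgue. indicator {0..} x *\<^sub>R f x = indicator {0..} x *\<^sub>R F x"
    using AE_completion[OF fF] by eventually_elim (auto simp: indicator_def split: if_splits)
  moreover have "(\<lambda>x. indicator {0..} x *\<^sub>R F x) \<in> borel_measurable lebesgue"
    by (intro measurable_completion) measurable
  ultimately have "integrable lebesgue (\<lambda>x. indicator {0..} x *\<^sub>R F x)"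
    using integrable_cong_AE_imp by blast
  then have "integrable lborel (\<lambda>x. indicator {0..} x *\<^sub>R F x)"
    by (subst (asm) integrable_completion) auto
  then have "integrable N h"
    by (simp add: integrable_N wh)
  then obtain p where p: "p \<in> cfun.span monomials" and ph: "(LINT x|N. norm (h x - p x)) < \<epsilon>"
    using tot \<epsilon> unfolding total_in_L1_def by blast
  have "integrable N p"
    using tot p by (auto simp: total_in_L1_def intro: integrable_span)
  then have p_borel[measurable]: "p \<in> borel_measurable borel"
    unfolding N_def by auto
  define g where "g s = complex_of_real (exp (- (a \<bullet> s))) * p (T s)" for s
  have "g \<in> cfun.span (exponentials a b)"
    using p unfolding g_def[abs_def]
  proof (induction rule: cfun.span_induct_alt)
    case base
    show ?case using cfun.span_zero by (simp add: zero_fun_def)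
  next
    case (step c q r)
    then obtain k where q: "q = (\<lambda>x. complex_of_real (\<Prod>j\<in>UNIV. (x $ j) ^ (k $ j)))"
      unfolding monomials_def by blast
    have "exp (- (a \<bullet> s)) * (\<Prod>j\<in>UNIV. (T s $ j) ^ (k $ j)) =
        exp (- (\<Sum>i\<in>UNIV. (a $ i + real (k $ i) * b $ i) * s $ i))" for s
    proof -
      have "(\<Prod>j\<in>UNIV. (T s $ j) ^ (k $ j)) = exp (\<Sum>j\<in>UNIV. - (real (k $ j) * b $ j * s $ j))"
        by (subst exp_sum) (auto simp: T_def mult.assoc simp flip: exp_of_nat_mult)
      then show ?thesis
        by (simp add: inner_vec_def flip: exp_add sum_negf sum.distrib) (simp add: algebra_simps sum_negf)
    qed
    then have "(\<lambda>s. complex_of_real (exp (- (a \<bullet> s))) * q (T s)) =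
        (\<lambda>s. complex_of_real (exp (- (\<Sum>i\<in>UNIV. (a $ i + real (k $ i) * b $ i) * s $ i))))"
      by (simp only: q flip: of_real_mult)
    then have "(\<lambda>s. complex_of_real (exp (- (a \<bullet> s))) * q (T s)) \<in> exponentials a b"
      unfolding exponentials_def by (rule range_eqI)
    then have "(\<lambda>s. c * (complex_of_real (exp (- (a \<bullet> s))) * q (T s))) +
        (\<lambda>s. complex_of_real (exp (- (a \<bullet> s))) * r (T s)) \<in> cfun.span (exponentials a b)"
      using step(2) by (intro cfun.span_add cfun.span_scale) (auto intro: cfun.span_base)
    then show ?case by (simp add: plus_fun_def algebra_simps)
  qed
  moreover have "(LINT x|lebesgue_on {0..}. norm (f x - g x)) < \<epsilon>"
  proof -
    have [measurable]: "g \<in> borel_measurable borel" unfolding g_def by measurable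
    have "(LINT x|lebesgue_on {0..}. norm (f x - g x)) = (LINT x|lebesgue. indicator {0..} x *\<^sub>R norm (f x - g x))"
      by (subst integral_restrict_space) auto
    also have "\<dots> = (LINT x|lebesgue. indicator {0..} x *\<^sub>R norm (F x - g x))"
    proof (rule integral_cong_AE)
      have "f \<in> borel_measurable (lebesgue_on {0..})" using f by auto
      moreover have "g \<in> borel_measurable (lebesgue_on {0..})"
        by (intro measurable_restrict_space1 measurable_completion) simp
      ultimately have "(\<lambda>x. norm (f x - g x)) \<in> borel_measurable (lebesgue_on {0..})" by measurable
      then show "(\<lambda>x. indicator {0..} x *\<^sub>R norm (f x - g x)) \<in> borel_measurable lebesgue"
        by (subst (asm) borel_measurable_restrict_space_iff) auto
      show "(\<lambda>x. indicator {0..} x *\<^sub>R norm (F x - g x)) \<in> borel_measurable lebesgue"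
        by (intro measurable_completion) measurable
      show "AE x in lebesgue. indicator {0..} x *\<^sub>R norm (f x - g x) = indicator {0..} x *\<^sub>R norm (F x - g x)"
        using AE_completion[OF fF] by eventually_elim (auto simp: indicator_def split: if_splits)
    qed
    also have "\<dots> = (LINT x|lborel. indicator {0..} x *\<^sub>R norm (F x - g x))"
      by (rule integral_completion) measurable
    also have "\<dots> = (LINT x|lborel. w x *\<^sub>R norm (h (T x) - p (T x)))"
    proof (intro Bochner_Integration.integral_cong refl)
      fix s
      have "h (T s) = exp (a \<bullet> s) *\<^sub>R F s" by (simp add: h_def RT)
      then have "w s *\<^sub>R (h (T s) - p (T s)) = indicator {0..} s *\<^sub>R (F s - g s)"
        by (simp add: w_def g_def exp_minus algebra_simps scaleR_conv_of_real)
      then have "norm (w s *\<^sub>R (h (T s) - p (T s))) = norm (indicator {0..} s *\<^sub>R (F s - g s))"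
        by simp
      then show "indicator {0..} s *\<^sub>R norm (F s - g s) = w s *\<^sub>R norm (h (T s) - p (T s))"
        using wnn[of s] by simp
    qed
    also have "\<dots> = (LINT x|N. norm (h x - p x))"
      by (rule integral_N[symmetric]) measurable
    finally show ?thesis using ph by simp
  qed
  ultimately show "\<exists>g\<in>cfun.span (exponentials a b). (LINT x|lebesgue_on {0..}. norm (f x - g x)) < \<epsilon>"
    by blast
qed

section \<open>Bounded functions annihilating a total set\<close>

text \<open>
  Integration against \<open>J\<close> is continuous in the \<open>L\<^sup>1\<close>-seminorm because \<open>J\<close> is bounded, so it vanishes
  on all integrable functions, in particular on \<open>w\<close> times the conjugate of \<open>J\<close>.  The weight \<open>w\<close> makes
  this function integrable when the measure is infinite.
\<close>
lemma bounded_annihilator_of_total_eq_0: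
  assumes tot: "total_in_L1 M E"
    and J[measurable]: "J \<in> borel_measurable M" and B: "\<And>x. x \<in> space M \<Longrightarrow> norm (J x) \<le> B"
    and w: "integrable M w" "\<And>x. x \<in> space M \<Longrightarrow> w x > (0::real)"
    and ann: "\<And>e. e \<in> E \<Longrightarrow> (LINT x|M. e x * J x) = 0"
  shows "AE x in M. J x = 0"
proof -
  have E: "E \<subseteq> {f. integrable M f}" using tot by (simp add: total_in_L1_def)
  have int_mult: "integrable M (\<lambda>x. g x * J x)" if g: "integrable M g" for g :: "'a \<Rightarrow> complex"
  proof (rule Bochner_Integration.integrable_bound)
    show "integrable M (\<lambda>x. B * norm (g x))" using g by auto
    show "AE x in M. norm (g x * J x) \<le> norm (B * norm (g x))"
    proof (rule AE_I2)
      fix x assume "x \<in> space M"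
      then have "norm (J x) \<le> \<bar>B\<bar>" using B[of x] by linarith
      then show "norm (g x * J x) \<le> norm (B * norm (g x))"
        by (simp add: norm_mult abs_mult mult.commute mult_right_mono)
    qed
  qed (use g in measurable)
  have span0: "(LINT x|M. g x * J x) = 0" if "g \<in> cfun.span E" for g
  proof -
    have "cfun.subspace {g. integrable M g \<and> (LINT x|M. g x * J x) = 0}"
      by (auto simp: cfun.subspace_def zero_fun_def plus_fun_def int_mult distrib_right mult.assoc)
    moreover have "E \<subseteq> {g. integrable M g \<and> (LINT x|M. g x * J x) = 0}"
      using E ann by auto
    ultimately have "cfun.span E \<subseteq> {g. integrable M g \<and> (LINT x|M. g x * J x) = 0}"
      by (rule cfun.span_minimal[rotated])
    then show ?thesis using that by auto
  qed
  define h where "h x = complex_of_real (w x) * cnj (J x)" for x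
  have h: "integrable M h"
  proof (rule Bochner_Integration.integrable_bound)
    show "integrable M (\<lambda>x. complex_of_real (w x) * J x)"
      using w(1) by (intro int_mult integrable_of_real)
    have "w \<in> borel_measurable M" "cnj \<in> borel_measurable borel"
      using w(1) by (auto intro: borel_measurable_continuous_onI continuous_intros)
    then show "h \<in> borel_measurable M" unfolding h_def by measurable
  qed (auto simp: h_def norm_mult)
  define r where "r x = w x * (norm (J x))\<^sup>2" for x
  have hJ: "h x * J x = complex_of_real (r x)" for x
    by (simp add: h_def r_def complex_norm_square mult.assoc mult.commute[of "cnj _"] flip: of_real_power)
  have r: "integrable M r"
    using integrable_Re[OF int_mult[OF h]] by (simp only: hJ Re_complex_of_real)
  have rnn: "r x \<ge> 0" if "x \<in> space M" for x using w(2)[OF that] by (simp add: r_def)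
  have "(LINT x|M. r x) \<le> \<bar>B\<bar> * \<epsilon>" if "\<epsilon> > 0" for \<epsilon>
  proof -
    obtain g where g: "g \<in> cfun.span E" "(LINT x|M. norm (h x - g x)) < \<epsilon>"
      using tot h \<open>\<epsilon> > 0\<close> unfolding total_in_L1_def by blast
    have gi: "integrable M g" by (rule integrable_span[OF E g(1)])
    have "complex_of_real (LINT x|M. r x) = (LINT x|M. h x * J x) - (LINT x|M. g x * J x)"
      by (simp add: hJ span0[OF g(1)])
    also have "\<dots> = (LINT x|M. (h x - g x) * J x)"
      by (subst Bochner_Integration.integral_diff[symmetric]) (auto intro: int_mult h gi simp: left_diff_distrib)
    finally have "norm (complex_of_real (LINT x|M. r x)) = norm (LINT x|M. (h x - g x) * J x)" by simp
    also have "\<dots> \<le> (LINT x|M. norm ((h x - g x) * J x))"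
      by (rule integral_norm_bound)
    also have "\<dots> \<le> (LINT x|M. \<bar>B\<bar> * norm (h x - g x))"
    proof (rule integral_mono)
      show "norm ((h x - g x) * J x) \<le> \<bar>B\<bar> * norm (h x - g x)" if "x \<in> space M" for x
      proof -
        have "norm (J x) \<le> \<bar>B\<bar>" using B[OF that] by linarith
        then show ?thesis by (simp add: norm_mult mult.commute mult_right_mono)
      qed
    qed (use int_mult[of "\<lambda>x. h x - g x"] h gi in auto)
    also have "\<dots> = \<bar>B\<bar> * (LINT x|M. norm (h x - g x))" by simp
    also have "\<dots> \<le> \<bar>B\<bar> * \<epsilon>" using g(2) by (intro mult_left_mono) auto
    finally show ?thesis by simp
  qed
  note r_le = this
  have "(LINT x|M. r x) \<le> 0 + \<epsilon>" if "\<epsilon> > 0" for \<epsilon>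
  proof -
    have "(LINT x|M. r x) \<le> \<bar>B\<bar> * (\<epsilon> / (\<bar>B\<bar> + 1))"
      using that by (intro r_le divide_pos_pos) auto
    also have "\<dots> \<le> \<epsilon>" using that by (simp add: field_simps)
    finally show ?thesis by simp
  qed
  then have "(LINT x|M. r x) \<le> 0" by (rule field_le_epsilon)
  moreover have "(LINT x|M. r x) \<ge> 0" by (rule Bochner_Integration.integral_nonneg) (rule rnn)
  ultimately have "(LINT x|M. r x) = 0" by linarith
  moreover have "AE x in M. 0 \<le> r x" using rnn by (rule AE_I2)
  ultimately have "AE x in M. r x = 0"
    using integral_nonneg_eq_0_iff_AE[OF r] by blast
  then show ?thesis
  proof (rule AE_mp, intro AE_I2 impI)
    fix x assume "x \<in> space M" "r x = 0"
    then show "J x = 0" using w(2)[of x] by (simp add: r_def)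
  qed
qed

section \<open>Integration by parts for partial Laplace transforms\<close>

text \<open>
  Up to the factor \<open>\<Prod>b\<in>Basis. d \<bullet> b\<close>, the value \<open>exp (- (d \<bullet> s))\<close> is the integral of
  \<open>exp (- (d \<bullet> u))\<close> over all \<open>u \<ge> s\<close>.  Inserting this and exchanging the integrals leaves for each \<open>u\<close>
  the integral of \<open>F\<close> over the \<open>s\<close> with \<open>0 \<le> s \<le> u\<close> and \<open>s \<le> t\<close>, that is, over
  \<open>{0..inf u t}\<close>.  In several variables this form avoids the boundary terms over all faces of the box.
\<close>
lemma laplace_integral_by_parts:
  fixes F :: "'a :: ordered_euclidean_space \<Rightarrow> complex"
  assumes d: "\<And>b. b \<in> Basis \<Longrightarrow> d \<bullet> b > 0"
    and F[measurable]: "F \<in> borel_measurable borel" and Fi: "set_integrable lborel {0..t} F"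
  shows "(LINT s:{0..t}|lborel. exp (- (d \<bullet> s)) *\<^sub>R F s) =
     (\<Prod>b\<in>Basis. d \<bullet> b) *\<^sub>R
       (LINT u:{0..}|lborel. exp (- (d \<bullet> u)) *\<^sub>R (LINT s:{0..inf u t}|lborel. F s))"
proof -
  define P where "P = (\<Prod>b\<in>Basis. d \<bullet> b)"
  have P: "P > 0" unfolding P_def using d by (intro prod_pos) auto
  define G where "G s = indicator {0..t} s *\<^sub>R F s" for s
  have G: "integrable lborel G" using Fi by (simp add: set_integrable_def G_def[abs_def])
  have [measurable]: "G \<in> borel_measurable borel" unfolding G_def by measurable
  define w where "w u = indicator {0..} u * exp (- (d \<bullet> u))" for u
  have w: "integrable lborel w"
    using has_integral_exp_orthant[of d 0] d by (simp add: has_bochner_integral_iff w_def[abs_def])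
  have wnn: "w u \<ge> 0" for u by (simp add: w_def)
  have [measurable]: "w \<in> borel_measurable borel" using w by auto
  define D :: "('a \<times> 'a) set" where "D = {p. snd p \<le> fst p}"
  have "D = (\<Inter>b\<in>Basis. {p. snd p \<bullet> b \<le> fst p \<bullet> b})"
    by (auto simp: D_def eucl_le[where 'a='a])
  also have "closed \<dots>"
    by (intro closed_INT ballI closed_Collect_le continuous_intros)
  finally have "D \<in> sets borel" by (rule borel_closed)
  then have D[measurable]: "D \<in> sets (borel \<Otimes>\<^sub>M borel)" by (simp only: borel_prod)
  define H where "H u s = (w u * indicator D (u, s)) *\<^sub>R G s" for u s
  have H_meas[measurable]: "case_prod H \<in> borel_measurable (borel \<Otimes>\<^sub>M borel)"
    unfolding H_def by measurable
  have normH: "norm (H u s) \<le> w u * norm (G s)" for u s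
    using wnn[of u] by (auto simp: H_def indicator_def)
  have Hs: "integrable lborel (H u)" for u
  proof (rule Bochner_Integration.integrable_bound)
    show "integrable lborel (\<lambda>s. w u * norm (G s))" using G by auto
    show "H u \<in> borel_measurable lborel" by measurable
    show "AE s in lborel. norm (H u s) \<le> norm (w u * norm (G s))"
      using normH by (intro AE_I2) (simp add: wnn)
  qed
  have "integrable (lborel \<Otimes>\<^sub>M lborel) (case_prod H)"
  proof (rule lborel_pair.Fubini_integrable)
    show "integrable lborel (\<lambda>u. LINT s|lborel. norm (case (u, s) of (u, s) \<Rightarrow> H u s))"
    proof (rule Bochner_Integration.integrable_bound)
      show "integrable lborel (\<lambda>u. w u * (LINT s|lborel. norm (G s)))" using w by auto
      show "(\<lambda>u. LINT s|lborel. norm (case (u, s) of (u, s) \<Rightarrow> H u s)) \<in> borel_measurable lborel"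
        by measurable
      show "AE u in lborel. norm (LINT s|lborel. norm (case (u, s) of (u, s) \<Rightarrow> H u s))
              \<le> norm (w u * (LINT s|lborel. norm (G s)))"
      proof (rule AE_I2)
        fix u
        have "(LINT s|lborel. norm (H u s)) \<le> (LINT s|lborel. w u * norm (G s))"
          using G Hs normH by (intro integral_mono) auto
        then show "norm (LINT s|lborel. norm (case (u, s) of (u, s) \<Rightarrow> H u s))
              \<le> norm (w u * (LINT s|lborel. norm (G s)))"
          using wnn[of u] by (simp add: abs_mult)
      qed
    qed
  qed (use Hs in auto)
  from lborel_pair.Fubini_integral[OF this]
  have fub: "(LINT s|lborel. LINT u|lborel. H u s) = (LINT u|lborel. LINT s|lborel. H u s)" .
  have inner_u: "P *\<^sub>R (LINT u|lborel. H u s) = indicator {0..t} s *\<^sub>R (exp (- (d \<bullet> s)) *\<^sub>R F s)" for s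
  proof -
    have "H u s = (indicator {s..} u * exp (- (d \<bullet> u))) *\<^sub>R G s" for u
      by (auto simp: H_def w_def G_def D_def indicator_def)
    then have "(LINT u|lborel. H u s) = (exp (- (d \<bullet> s)) / P) *\<^sub>R G s"
      using has_integral_exp_orthant[OF d, of s]
      by (simp add: has_bochner_integral_iff P_def)
    then show ?thesis using P by (simp add: G_def)
  qed
  have inner_s: "(LINT s|lborel. H u s) =
      indicator {0..} u *\<^sub>R (exp (- (d \<bullet> u)) *\<^sub>R (LINT s:{0..inf u t}|lborel. F s))" for u
  proof -
    have "H u s = w u *\<^sub>R (indicator {0..inf u t} s *\<^sub>R F s)" for s
      by (auto simp: H_def G_def D_def indicator_def)
    then have "(LINT s|lborel. H u s) = w u *\<^sub>R (LINT s|lborel. indicator {0..inf u t} s *\<^sub>R F s)"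
      by (simp only: integral_scaleR_right)
    then show ?thesis by (simp add: set_lebesgue_integral_def w_def)
  qed
  have "P *\<^sub>R (LINT s|lborel. LINT u|lborel. H u s) = (LINT s|lborel. P *\<^sub>R (LINT u|lborel. H u s))"
    by simp
  then show ?thesis
    unfolding fub inner_u inner_s by (simp add: set_lebesgue_integral_def P_def)
qed

section \<open>Functions whose box integrals vanish\<close>

lemma AE_lborel_ex_in_box:
  fixes l u :: "'a :: euclidean_space"
  assumes "AE x in lborel. P x" and "\<And>b. b \<in> Basis \<Longrightarrow> l \<bullet> b < u \<bullet> b"
  shows "\<exists>x\<in>box l u. P x"
proof (rule ccontr)
  assume "\<not> (\<exists>x\<in>box l u. P x)"
  then have "AE x in lborel. x \<notin> box l u"
    using assms(1) by (auto elim: eventually_mono)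
  then have "box l u \<in> null_sets lborel"
    by (simp add: AE_iff_null_sets)
  moreover have "emeasure lborel (box l u) > 0"
    using assms(2) by (subst emeasure_lborel_box) (auto intro!: prod_pos simp: less_imp_le inner_diff_left)
  ultimately show False by auto
qed

text \<open>
  The integral over \<open>{0..u}\<close> is continuous from above in \<open>u\<close>, and points of a set of full measure
  accumulate at every \<open>u\<close> from strictly above.
\<close>
lemma box_integral_eq_0_if_AE:
  fixes F :: "'a :: ordered_euclidean_space \<Rightarrow> complex"
  assumes F[measurable]: "F \<in> borel_measurable borel"
    and Fi: "\<And>t. set_integrable lborel {0..t} F"
    and ae: "AE u in lborel. u \<ge> 0 \<longrightarrow> (LINT s:{0..u}|lborel. F s) = 0"
    and u: "u \<ge> 0"
  shows "(LINT s:{0..u}|lborel. F s) = 0"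
proof -
  have "\<exists>v\<in>box u (u + (1 / real (Suc m)) *\<^sub>R One). v \<ge> 0 \<longrightarrow> (LINT s:{0..v}|lborel. F s) = 0" for m
    by (rule AE_lborel_ex_in_box[OF ae]) (simp add: inner_add_left)
  then obtain v where v: "\<And>m. v m \<in> box u (u + (1 / real (Suc m)) *\<^sub>R One)"
    and v0: "\<And>m. v m \<ge> 0 \<Longrightarrow> (LINT s:{0..v m}|lborel. F s) = 0"
    by metis
  have v_gt: "u \<bullet> b < v m \<bullet> b" and v_lt: "v m \<bullet> b < u \<bullet> b + 1 / real (Suc m)" if "b \<in> Basis" for b m
    using v[of m] that by (auto simp: mem_box inner_add_left)
  have uv: "u \<le> v m" for m
    using v_gt by (auto simp: eucl_le[where 'a='a] less_imp_le)
  have vu: "v m \<le> u + One" for m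
    unfolding eucl_le[where 'a='a]
  proof
    fix b :: 'a assume b: "b \<in> Basis"
    have "1 / real (Suc m) \<le> 1" and "(u + One) \<bullet> b = u \<bullet> b + 1"
      using b by (simp_all add: inner_add_left)
    then show "v m \<bullet> b \<le> (u + One) \<bullet> b"
      using v_lt[OF b, of m] by linarith
  qed
  have "(\<lambda>m. LINT s:{0..v m}|lborel. F s) \<longlonglongrightarrow> (LINT s:{0..u}|lborel. F s)"
    unfolding set_lebesgue_integral_def
  proof (rule integral_dominated_convergence)
    show "integrable lborel (\<lambda>s. norm (indicator {0..u + One} s *\<^sub>R F s))"
      using Fi[of "u + One"] by (simp only: set_integrable_def integrable_norm)
    show "AE s in lborel. norm (indicator {0..v m} s *\<^sub>R F s) \<le> norm (indicator {0..u + One} s *\<^sub>R F s)" for m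
      using order_trans[OF _ vu[of m]] by (intro AE_I2) (auto simp: indicator_def)
    show "AE s in lborel. (\<lambda>m. indicator {0..v m} s *\<^sub>R F s) \<longlonglongrightarrow> indicator {0..u} s *\<^sub>R F s"
    proof (rule AE_I2)
      fix s
      have "\<forall>\<^sub>F m in sequentially. s \<le> v m \<longleftrightarrow> s \<le> u"
      proof (cases "s \<le> u")
        case True
        then show ?thesis using uv order_trans by (intro always_eventually) blast
      next
        case False
        then obtain b where b: "b \<in> Basis" "u \<bullet> b < s \<bullet> b"
          by (auto simp: eucl_le[where 'a='a] not_le)
        have "(\<lambda>m. u \<bullet> b + 1 / real (Suc m)) \<longlonglongrightarrow> u \<bullet> b"
          using tendsto_add[OF tendsto_const LIMSEQ_inverse_real_of_nat, of "u \<bullet> b"]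
          by (simp add: inverse_eq_divide)
        then have "\<forall>\<^sub>F m in sequentially. u \<bullet> b + 1 / real (Suc m) < s \<bullet> b"
          using b(2) by (rule order_tendstoD)
        then show ?thesis
        proof eventually_elim
          case (elim m)
          then have "v m \<bullet> b < s \<bullet> b" using v_lt[OF b(1), of m] by linarith
          then have "\<not> s \<le> v m" using b(1) by (auto simp: eucl_le[where 'a='a] not_le)
          then show ?case using False by simp
        qed
      qed
      then have "\<forall>\<^sub>F m in sequentially. indicator {0..v m} s *\<^sub>R F s = indicator {0..u} s *\<^sub>R F s"
        by eventually_elim (simp add: indicator_def)
      then show "(\<lambda>m. indicator {0..v m} s *\<^sub>R F s) \<longlonglongrightarrow> indicator {0..u} s *\<^sub>R F s"
        by (rule tendsto_eventually)
    qed
  qed (use Fi in \<open>auto simp: set_integrable_def\<close>)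
  moreover have "(LINT s:{0..v m}|lborel. F s) = 0" for m
    using v0[of m] order_trans[OF u uv] by blast
  ultimately show ?thesis using LIMSEQ_unique[OF _ tendsto_const] by simp
qed

text \<open>
  Cut off at a box \<open>{0..t}\<close>, the function is integrable, and its integral over \<open>{..u}\<close> is one over
  \<open>{0..inf u t}\<close>, hence zero.  The sets \<open>{..u}\<close> form an intersection-stable generator of the Borel sets,
  so the integral over every Borel set is zero.
\<close>
lemma AE_eq_0_if_box_integrals_eq_0:
  fixes F :: "'a :: ordered_euclidean_space \<Rightarrow> complex"
  assumes F[measurable]: "F \<in> borel_measurable borel"
    and Fi: "\<And>t. set_integrable lborel {0..t} F"
    and zero: "\<And>u. u \<ge> 0 \<Longrightarrow> (LINT s:{0..u}|lborel. F s) = 0"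
  shows "AE s in lborel. s \<ge> 0 \<longrightarrow> F s = 0"
proof -
  have zero': "(LINT s:{0..u}|lborel. F s) = 0" for u
    using zero[of u] by (cases "u \<ge> 0") (auto simp: set_lebesgue_integral_def)
  have "AE s in lborel. indicator {0..t} s *\<^sub>R F s = 0" for t
  proof (rule sigma_finite_measure.density_zero[OF sigma_finite_lborel])
    show i: "integrable lborel (\<lambda>s. indicator {0..t} s *\<^sub>R F s)"
      using Fi by (simp add: set_integrable_def)
    have si: "set_integrable lborel A (\<lambda>s. indicator {0..t} s *\<^sub>R F s)" if "A \<in> sets borel" for A
      unfolding set_integrable_def using that by (intro integrable_mult_indicator[OF _ i]) auto
    fix A :: "'a set" assume "A \<in> sets lborel"
    then have A: "A \<in> sigma_sets UNIV (range (\<lambda>a. {..a}))"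
      by (simp add: borel_eq_atMost)
    have int: "Int_stable (range (\<lambda>a :: 'a. {..a}))"
    proof (rule Int_stableI)
      fix X Y :: "'a set" assume "X \<in> range (\<lambda>a. {..a})" "Y \<in> range (\<lambda>a. {..a})"
      then obtain x y where "X = {..x}" "Y = {..y}" by blast
      then have "X \<inter> Y = {..inf x y}" by auto
      then show "X \<inter> Y \<in> range (\<lambda>a. {..a})" by blast
    qed
    have pow: "range (\<lambda>a :: 'a. {..a}) \<subseteq> Pow UNIV" by simp
    have borel: "B \<in> sets borel" if "B \<in> sigma_sets UNIV (range (\<lambda>a :: 'a. {..a}))" for B
      using that by (simp add: borel_eq_atMost)
    from int pow A show "(LINT s:A|lborel. indicator {0..t} s *\<^sub>R F s) = 0"
    proof (induction rule: sigma_sets_induct_disjoint)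
      case (basic A)
      then obtain u where "A = {..u}" by blast
      then have "indicator A s *\<^sub>R (indicator {0..t} s *\<^sub>R F s) = indicator {0..inf u t} s *\<^sub>R F s" for s
        by (auto simp: indicator_def)
      then show ?case using zero'[of "inf u t"] by (simp only: set_lebesgue_integral_def)
    next
      case empty
      show ?case by (simp add: set_lebesgue_integral_def)
    next
      case (compl A)
      have "(LINT s:UNIV|lborel. indicator {0..t} s *\<^sub>R F s) = 0"
        using zero'[of t] by (simp add: set_lebesgue_integral_def)
      moreover have "(LINT s:A \<union> (UNIV - A)|lborel. indicator {0..t} s *\<^sub>R F s) =
         (LINT s:A|lborel. indicator {0..t} s *\<^sub>R F s) + (LINT s:UNIV - A|lborel. indicator {0..t} s *\<^sub>R F s)"
        using borel[OF compl(1)] by (intro set_integral_Un si) auto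
      ultimately show ?case using compl(2) by simp
    next
      case (union A)
      have A: "A i \<in> sets borel" for i using union(2) borel by blast
      have "(LINT s:(\<Union>i. A i)|lborel. indicator {0..t} s *\<^sub>R F s) =
          (\<Sum>i. (LINT s:A i|lborel. indicator {0..t} s *\<^sub>R F s))"
        using union(1) A by (intro lebesgue_integral_countable_add si) (auto simp: disjoint_family_on_def)
      then show ?case using union(3) by simp
    qed
  qed
  then have "AE s in lborel. \<forall>m::nat. indicator {0..real m *\<^sub>R One} s *\<^sub>R F s = 0"
    by (subst AE_all_countable) blast
  then show ?thesis
  proof eventually_elim
    case (elim s)
    show ?case
    proof
      assume s: "s \<ge> 0"
      obtain m :: nat where m: "norm s \<le> real m" using real_arch_simple by blast
      have "s \<le> real m *\<^sub>R One"
        unfolding eucl_le[where 'a='a]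
      proof
        fix b :: 'a assume b: "b \<in> Basis"
        have "s \<bullet> b \<le> norm s" using Basis_le_norm[OF b, of s] by linarith
        then show "s \<bullet> b \<le> (real m *\<^sub>R One) \<bullet> b" using m b by simp
      qed
      then show "F s = 0" using s elim[rule_format, of m] by simp
    qed
  qed
qed

section \<open>Uniqueness of the Laplace transform on an arithmetic grid\<close>

lemma vec_le_const:
  fixes t :: "real ^ 'n"
  assumes "norm t \<le> r"
  shows "t \<le> (\<chi> j. r)"
  unfolding less_eq_vec_def
proof
  fix j
  show "t $ j \<le> (\<chi> j. r) $ j" using component_le_norm_cart[of t j] assms by simp
qed

text \<open>
  Passing from Lebesgue to Borel measurable functions makes the theorem of Fubini available for the
  product of \<open>lborel\<close> with itself.
\<close>
lemma loc_integrable_borel_representative: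
  assumes f: "loc_integrable (f :: real ^ 'n \<Rightarrow> complex)"
  obtains F where "(\<lambda>s. indicator {0..} s *\<^sub>R f s) \<in> borel_measurable lebesgue" and "F \<in> borel_measurable borel"
    and "AE s in lborel. s \<ge> 0 \<longrightarrow> f s = F s"
    and "\<And>t. set_integrable lborel {0..t} F"
proof -
  have f_meas: "(\<lambda>s. indicator {0..} s *\<^sub>R f s) \<in> borel_measurable lebesgue"
  proof (rule borel_measurable_LIMSEQ_metric)
    show "(\<lambda>s. indicator {0..(\<chi> j. real m)} s *\<^sub>R f s) \<in> borel_measurable lebesgue" for m
      using f unfolding loc_integrable_def set_integrable_def by (intro borel_measurable_integrable) blast
    fix s :: "real ^ 'n"
    obtain m0 :: nat where m0: "norm s \<le> real m0" using real_arch_simple by blast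
    have "\<forall>\<^sub>F m in sequentially. indicator {0..(\<chi> j. real m)} s *\<^sub>R f s = indicator {0..} s *\<^sub>R f s"
      using eventually_ge_at_top[of m0]
    proof eventually_elim
      case (elim m)
      have "s \<le> (\<chi> j. real m)" using m0 elim by (intro vec_le_const) linarith
      then show ?case by (simp add: indicator_def)
    qed
    then show "(\<lambda>m. indicator {0..(\<chi> j. real m)} s *\<^sub>R f s) \<longlonglongrightarrow> indicator {0..} s *\<^sub>R f s"
      by (rule tendsto_eventually)
  qed
  then obtain F where F[measurable]: "F \<in> borel_measurable borel"
    and fF: "AE s in lborel. indicator {0..} s *\<^sub>R f s = F s"
    using ex_borel_representative by blast
  have ae: "AE s in lborel. s \<ge> 0 \<longrightarrow> f s = F s"
    using fF by eventually_elim (auto simp: indicator_def split: if_splits)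
  have int: "set_integrable lborel {0..t} F" for t
  proof -
    define T where "T = norm t"
    have t: "t \<le> (\<chi> j. T)" by (rule vec_le_const) (simp add: T_def)
    have "integrable lebesgue (\<lambda>s. indicator {0..(\<chi> j. T)} s *\<^sub>R f s)"
      using f by (auto simp: loc_integrable_def set_integrable_def)
    moreover have "AE s in lebesgue. indicator {0..(\<chi> j. T)} s *\<^sub>R f s = indicator {0..(\<chi> j. T)} s *\<^sub>R F s"
      using AE_completion[OF ae] by eventually_elim (auto simp: indicator_def)
    moreover have "(\<lambda>s. indicator {0..(\<chi> j. T)} s *\<^sub>R F s) \<in> borel_measurable lebesgue"
      by (intro measurable_completion) measurable
    ultimately have "integrable lebesgue (\<lambda>s. indicator {0..(\<chi> j. T)} s *\<^sub>R F s)"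
      using integrable_cong_AE_imp by blast
    then have "set_integrable lborel {0..(\<chi> j. T)} F"
      unfolding set_integrable_def by (subst (asm) integrable_completion) auto
    then show ?thesis
      by (rule set_integrable_subset) (use t order_trans in auto)
  qed
  show ?thesis by (rule that[OF f_meas F ae int])
qed

lemma laplace_partial_real:
  fixes F f :: "real ^ 'n \<Rightarrow> complex"
  assumes [measurable]: "F \<in> borel_measurable borel" and ae: "AE s in lborel. s \<ge> 0 \<longrightarrow> f s = F s"
    and f: "(\<lambda>s. indicator {0..} s *\<^sub>R f s) \<in> borel_measurable lebesgue"
  shows "laplace_partial f (\<chi> i. complex_of_real (l $ i)) t = (LINT s:{0..t}|lborel. exp (- (l \<bullet> s)) *\<^sub>R F s)"
proof -
  have e: "exp (- (\<Sum>j\<in>UNIV. (\<chi> i. complex_of_real (l $ i)) $ j * complex_of_real (s $ j))) = complex_of_real (exp (- (l \<bullet> s)))" for s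
    by (simp add: inner_vec_def exp_of_real flip: of_real_mult of_real_sum of_real_minus)
  have aeL: "AE s in lebesgue. s \<ge> 0 \<longrightarrow> f s = F s" by (rule AE_completion[OF ae])
  have G: "(\<lambda>s. indicator {0..t} s *\<^sub>R (exp (- (l \<bullet> s)) *\<^sub>R F s)) \<in> borel_measurable borel" by measurable
  have GL: "(\<lambda>s. indicator {0..t} s *\<^sub>R (exp (- (l \<bullet> s)) *\<^sub>R F s)) \<in> borel_measurable lebesgue"
    using G by (intro measurable_completion) simp
  have ae2: "AE s in lebesgue. indicator {0..t} s *\<^sub>R (exp (- (l \<bullet> s)) *\<^sub>R F s) = indicator {0..t} s *\<^sub>R (exp (- (l \<bullet> s)) *\<^sub>R f s)"
    using aeL by eventually_elim (auto simp: indicator_def)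
  have "laplace_partial f (\<chi> i. complex_of_real (l $ i)) t =
      (LINT s|lebesgue. indicator {0..t} s *\<^sub>R (exp (- (l \<bullet> s)) *\<^sub>R f s))"
    unfolding laplace_partial_def set_lebesgue_integral_def e by (simp add: scaleR_conv_of_real)
  also have "\<dots> = (LINT s|lebesgue. indicator {0..t} s *\<^sub>R (exp (- (l \<bullet> s)) *\<^sub>R F s))"
  proof (rule integral_cong_AE)
    have "(\<lambda>s. indicator {0..t} s * exp (- (l \<bullet> s))) \<in> borel_measurable lebesgue"
      by (intro measurable_completion) measurable
    then have "(\<lambda>s. (indicator {0..t} s * exp (- (l \<bullet> s))) *\<^sub>R (indicator {0..} s *\<^sub>R f s)) \<in> borel_measurable lebesgue"
      using f by (rule borel_measurable_scaleR)
    also have "(\<lambda>s. (indicator {0..t} s * exp (- (l \<bullet> s))) *\<^sub>R (indicator {0..} s *\<^sub>R f s)) =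
        (\<lambda>s. indicator {0..t} s *\<^sub>R (exp (- (l \<bullet> s)) *\<^sub>R f s))"
      by (auto simp: fun_eq_iff indicator_def)
    finally show "(\<lambda>s. indicator {0..t} s *\<^sub>R (exp (- (l \<bullet> s)) *\<^sub>R f s)) \<in> borel_measurable lebesgue" .
  qed (use GL ae2 in auto)
  also have "\<dots> = (LINT s|lborel. indicator {0..t} s *\<^sub>R (exp (- (l \<bullet> s)) *\<^sub>R F s))"
    using G by (intro integral_completion) simp
  finally show ?thesis by (simp add: set_lebesgue_integral_def)
qed

lemma filterlim_const_vec_at_top: "filterlim (\<lambda>m::nat. (\<chi> j. real m) :: real ^ 'n) at_top sequentially"
  unfolding filterlim_iff eventually_at_top_vec
proof safe
  fix P :: "real ^ 'n \<Rightarrow> bool" and T :: real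
  assume P: "\<forall>t. (\<forall>j. T \<le> t $ j) \<longrightarrow> P t"
  obtain m0 :: nat where "T \<le> real m0" using real_arch_simple by blast
  then show "\<forall>\<^sub>F m in sequentially. P (\<chi> j. real m)"
    unfolding eventually_sequentially
    by (intro exI[of _ m0] allI impI P[rule_format]) (simp add: order_trans)
qed

text \<open>
  One point \<open>c\<close> below the grid at which the partial transforms are bounded suffices: relative to \<open>c\<close>
  the grid points are \<open>a - c + k b\<close> with \<open>a - c\<close> positive, which is again a grid whose exponentials are
  total.
\<close>
lemma AE_eq_0_if_laplace_eq_0:
  fixes f :: "real ^ 'n \<Rightarrow> complex"
  assumes f: "loc_integrable f"
    and c: "\<And>i. c $ i < a $ i" and b: "\<And>i. b $ i > 0"
    and bdd: "bounded (laplace_partial f (\<chi> i. complex_of_real (c $ i)) ` {0..})"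
    and lim: "\<And>k :: nat ^ 'n. (laplace_partial f (\<chi> i. complex_of_real (a $ i + real (k $ i) * b $ i)) \<longlongrightarrow> 0) at_top"
  shows "AE t in lebesgue_on {0..}. f t = 0"
proof -
  obtain F where f_meas: "(\<lambda>s. indicator {0..} s *\<^sub>R f s) \<in> borel_measurable lebesgue"
    and F[measurable]: "F \<in> borel_measurable borel"
    and ae: "AE s in lborel. s \<ge> 0 \<longrightarrow> f s = F s"
    and Fi: "\<And>t. set_integrable lborel {0..t} F"
    using loc_integrable_borel_representative[OF f] by blast
  note partial = laplace_partial_real[OF F ae f_meas]
  define G where "G s = exp (- (c \<bullet> s)) *\<^sub>R F s" for s
  have G[measurable]: "G \<in> borel_measurable borel" unfolding G_def by measurable
  have Gi: "set_integrable lborel {0..t} G" for t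
  proof -
    have "compact ((\<lambda>s. exp (- (c \<bullet> s))) ` {0..t})"
      by (intro compact_continuous_image continuous_intros compact_interval)
    then obtain K where K: "\<And>s. s \<in> {0..t} \<Longrightarrow> norm (exp (- (c \<bullet> s))) \<le> K"
      by (meson bounded_iff compact_imp_bounded image_eqI)
    show ?thesis
      unfolding set_integrable_def
    proof (rule Bochner_Integration.integrable_bound)
      show "integrable lborel (\<lambda>s. K *\<^sub>R (indicator {0..t} s *\<^sub>R F s))"
        using Fi[of t] unfolding set_integrable_def by (rule integrable_scaleR_right)
      show "AE s in lborel. norm (indicator {0..t} s *\<^sub>R G s) \<le> norm (K *\<^sub>R (indicator {0..t} s *\<^sub>R F s))"
      proof (rule AE_I2)
        fix s
        show "norm (indicator {0..t} s *\<^sub>R G s) \<le> norm (K *\<^sub>R (indicator {0..t} s *\<^sub>R F s))"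
        proof (cases "s \<in> {0..t}")
          case True
          then have "exp (- (c \<bullet> s)) \<le> \<bar>K\<bar>" using K[OF True] by simp
          then show ?thesis using True by (simp add: G_def mult_right_mono)
        qed auto
      qed
    qed measurable
  qed
  define J where "J u = (LINT s:{0..u}|lborel. G s)" for u
  have "closed {p :: (real ^ 'n) \<times> (real ^ 'n). 0 \<le> snd p \<and> snd p \<le> fst p}"
    unfolding less_eq_vec_def
    by (intro closed_Collect_conj closed_Collect_all closed_Collect_le continuous_intros)
  then have [measurable]: "{p :: (real ^ 'n) \<times> (real ^ 'n). 0 \<le> snd p \<and> snd p \<le> fst p} \<in> sets (borel \<Otimes>\<^sub>M borel)"
    (is "?D \<in> _") by (simp only: borel_prod borel_closed)
  have "J = (\<lambda>u. LINT s|lborel. indicator ?D (u, s) *\<^sub>R G s)"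
    by (auto simp: J_def set_lebesgue_integral_def indicator_def intro!: Bochner_Integration.integral_cong)
  then have J[measurable]: "J \<in> borel_measurable borel" by simp
  \<comment> \<open>\<open>J\<close> is the partial transform of \<open>f\<close> at \<open>c\<close>.\<close>
  obtain B where B: "\<And>u. u \<ge> 0 \<Longrightarrow> norm (J u) \<le> B"
    using bdd by (auto simp: bounded_iff J_def G_def partial)
  have B0: "B \<ge> 0" using B[of 0] norm_ge_zero order_trans by blast
  have ann: "(LINT u:{0..}|lborel. exp (- (d \<bullet> u)) *\<^sub>R J u) = 0"
    if d: "d = (\<chi> i. (a $ i - c $ i) + real (k $ i) * b $ i)" for d and k :: "nat ^ 'n"
  proof -
    have dpos: "d $ i > 0" for i using b[of i] c[of i] by (simp add: d add_pos_nonneg)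
    note dpos' = Basis_vec_pos[OF dpos]
    define P where "P = (\<Prod>v\<in>Basis. d \<bullet> v)"
    have P: "P > 0" unfolding P_def using dpos' by (intro prod_pos) auto
    define t :: "nat \<Rightarrow> real ^ 'n" where "t m = (\<chi> j. real m)" for m
    have t0: "t m \<ge> 0" for m by (simp add: t_def less_eq_vec_def)
    have [measurable]: "(\<lambda>u :: real ^ 'n. inf u x) \<in> borel_measurable borel" for x
      unfolding eucl_inf inf_min by measurable
    have "(\<lambda>m. LINT u:{0..}|lborel. exp (- (d \<bullet> u)) *\<^sub>R J (inf u (t m)))
        \<longlonglongrightarrow> (LINT u:{0..}|lborel. exp (- (d \<bullet> u)) *\<^sub>R J u)"
      unfolding set_lebesgue_integral_def
    proof (rule integral_dominated_convergence)
      show "integrable lborel (\<lambda>u. B * (indicator {0..} u * exp (- (d \<bullet> u))))"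
        using has_integral_exp_orthant[OF dpos', of 0] by (simp add: has_bochner_integral_iff)
      show "AE u in lborel. norm (indicator {0..} u *\<^sub>R exp (- (d \<bullet> u)) *\<^sub>R J (inf u (t m)))
          \<le> B * (indicator {0..} u * exp (- (d \<bullet> u)))" for m
      proof (rule AE_I2)
        fix u :: "real ^ 'n"
        show "norm (indicator {0..} u *\<^sub>R exp (- (d \<bullet> u)) *\<^sub>R J (inf u (t m)))
          \<le> B * (indicator {0..} u * exp (- (d \<bullet> u)))"
        proof (cases "u \<ge> 0")
          case True
          then have "norm (J (inf u (t m))) \<le> B" using t0[of m] by (intro B) simp
          then show ?thesis using True by (simp add: mult.commute mult_right_mono)
        qed simp
      qed
      show "AE u in lborel. (\<lambda>m. indicator {0..} u *\<^sub>R exp (- (d \<bullet> u)) *\<^sub>R J (inf u (t m)))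
          \<longlonglongrightarrow> indicator {0..} u *\<^sub>R exp (- (d \<bullet> u)) *\<^sub>R J u"
      proof (rule AE_I2)
        fix u :: "real ^ 'n"
        obtain m0 :: nat where m0: "norm u \<le> real m0" using real_arch_simple by blast
        have "u \<le> t m" if "m \<ge> m0" for m
          unfolding t_def using m0 that by (intro vec_le_const) linarith
        then have "\<forall>\<^sub>F m in sequentially. u \<le> t m"
          by (auto simp: eventually_sequentially)
        then have "\<forall>\<^sub>F m in sequentially. indicator {0..} u *\<^sub>R exp (- (d \<bullet> u)) *\<^sub>R J (inf u (t m))
            = indicator {0..} u *\<^sub>R exp (- (d \<bullet> u)) *\<^sub>R J u"
          by eventually_elim (simp add: inf_absorb1)
        then show "(\<lambda>m. indicator {0..} u *\<^sub>R exp (- (d \<bullet> u)) *\<^sub>R J (inf u (t m)))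
          \<longlonglongrightarrow> indicator {0..} u *\<^sub>R exp (- (d \<bullet> u)) *\<^sub>R J u"
          by (rule tendsto_eventually)
      qed
    qed measurable
    moreover have "(\<lambda>m. LINT u:{0..}|lborel. exp (- (d \<bullet> u)) *\<^sub>R J (inf u (t m))) \<longlonglongrightarrow> 0"
    proof -
      have eq: "laplace_partial f (\<chi> i. complex_of_real (a $ i + real (k $ i) * b $ i)) x =
          P *\<^sub>R (LINT u:{0..}|lborel. exp (- (d \<bullet> u)) *\<^sub>R J (inf u x))" for x
      proof -
        define l where "l = c + d"
        have "laplace_partial f (\<chi> i. complex_of_real (a $ i + real (k $ i) * b $ i)) x =
            laplace_partial f (\<chi> i. complex_of_real (l $ i)) x"
          by (simp add: l_def d)
        also have "\<dots> = (LINT s:{0..x}|lborel. exp (- (d \<bullet> s)) *\<^sub>R G s)"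
        proof -
          have "- (l \<bullet> s) = - (d \<bullet> s) + - (c \<bullet> s)" for s by (simp add: l_def inner_add_left)
          then show ?thesis unfolding partial by (simp only: G_def exp_add scaleR_scaleR)
        qed
        also have "\<dots> = P *\<^sub>R (LINT u:{0..}|lborel. exp (- (d \<bullet> u)) *\<^sub>R J (inf u x))"
          unfolding J_def P_def by (rule laplace_integral_by_parts[OF dpos' G Gi])
        finally show ?thesis .
      qed
      have "(\<lambda>m. laplace_partial f (\<chi> i. complex_of_real (a $ i + real (k $ i) * b $ i)) (t m)) \<longlonglongrightarrow> 0"
        using filterlim_compose[OF lim filterlim_const_vec_at_top] by (simp add: t_def)
      then have "(\<lambda>m. (1 / P) *\<^sub>R laplace_partial f (\<chi> i. complex_of_real (a $ i + real (k $ i) * b $ i)) (t m)) \<longlonglongrightarrow> (1 / P) *\<^sub>R 0"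
        by (intro tendsto_intros)
      then show ?thesis unfolding eq using P by simp
    qed
    ultimately show ?thesis by (rule LIMSEQ_unique)
  qed
  have tot: "total_in_L1 (lebesgue_on {0..}) (exponentials (a - c) b)"
    using b c by (intro exponentials_total_in_L1) auto
  have "AE u in lebesgue_on {0..}. J u = 0"
  proof (rule bounded_annihilator_of_total_eq_0[OF tot])
    show "J \<in> borel_measurable (lebesgue_on {0..})"
      by (intro measurable_restrict_space1 measurable_completion) simp
    show "norm (J u) \<le> B" if "u \<in> space (lebesgue_on {0..})" for u
      using that by (intro B) simp
    \<comment> \<open>Any positive integrable weight would do.\<close>
    show "integrable (lebesgue_on {0..}) (\<lambda>u :: real ^ 'n. exp (- (\<Sum>i\<in>UNIV. u $ i)))"
    proof -
      have "(1 :: real ^ 'n) $ i > 0" for i by simp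
      from integrable_Re[OF integrable_exp_orthant[OF this]] show ?thesis by simp
    qed
    show "(LINT u|lebesgue_on {0..}. e u * J u) = 0" if e_in: "e \<in> exponentials (a - c) b" for e
    proof -
      obtain k where e: "e = (\<lambda>t. complex_of_real (exp (- (\<Sum>i\<in>UNIV. ((a - c) $ i + real (k $ i) * b $ i) * t $ i))))"
        using e_in unfolding exponentials_def by (rule rangeE)
      define d where "d = (\<chi> i. (a $ i - c $ i) + real (k $ i) * b $ i)"
      have "(LINT u|lebesgue_on {0..}. e u * J u) = (LINT u|lebesgue. indicator {0..} u *\<^sub>R (exp (- (d \<bullet> u)) *\<^sub>R J u))"
        by (subst integral_restrict_space) (auto simp: e d_def inner_vec_def scaleR_conv_of_real)
      also have "\<dots> = (LINT u|lborel. indicator {0..} u *\<^sub>R (exp (- (d \<bullet> u)) *\<^sub>R J u))"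
        by (rule integral_completion) measurable
      also have "\<dots> = 0"
        using ann[OF d_def] by (simp add: set_lebesgue_integral_def)
      finally show ?thesis .
    qed
  qed auto
  then have "AE u in lborel. u \<ge> 0 \<longrightarrow> J u = 0"
    by (simp add: AE_restrict_space_iff AE_completion_iff)
  then have "(LINT s:{0..u}|lborel. G s) = 0" if "u \<ge> 0" for u
    using box_integral_eq_0_if_AE[OF G Gi _ that] by (simp add: J_def)
  then have "AE s in lborel. s \<ge> 0 \<longrightarrow> G s = 0"
    by (rule AE_eq_0_if_box_integrals_eq_0[OF G Gi])
  with ae have "AE s in lborel. s \<ge> 0 \<longrightarrow> f s = 0"
    by eventually_elim (simp add: G_def)
  then show ?thesis
    by (simp add: AE_restrict_space_iff AE_completion)
qed

text \<open>
  The enumeration is onto, so it meets every grid point.  The one with \<open>k = 0\<close> gives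
  \<open>\<omega>\<^sub>j < a\<^sub>j\<close> and thereby room for a real \<open>c\<^sub>j\<close> between them, also when \<open>\<omega>\<^sub>j = -\<infinity>\<close>.
\<close>
theorem arithmetic_grid_uniqueness_family:
  fixes a b :: "real ^ 'n"
  assumes b: "\<And>i. b $ i > 0"
  shows "uniqueness_family (\<lambda>k :: nat ^ 'n. \<chi> i. complex_of_real (a $ i + real (k $ i) * b $ i))"
  unfolding uniqueness_family_def uniqueness_sequence_def
proof (intro allI impI, elim exE conjE)
  fix \<sigma> :: "nat \<Rightarrow> nat ^ 'n" and f :: "real ^ 'n \<Rightarrow> complex" and \<omega> :: "'n \<Rightarrow> ereal"
  define l where "l = (\<lambda>k :: nat ^ 'n. \<chi> i. complex_of_real (a $ i + real (k $ i) * b $ i))"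
  assume \<sigma>: "bij \<sigma>" and f: "loc_integrable f"
    and zero: "\<forall>m. laplace f (((\<lambda>k :: nat ^ 'n. \<chi> i. complex_of_real (a $ i + real (k $ i) * b $ i)) \<circ> \<sigma>) m) = 0"
    and dom: "{z. \<forall>j. \<omega> j < ereal (Re (z $ j))} \<subseteq> laplace_bdd_dom f \<inter> laplace_dom f"
    and \<omega>: "\<forall>m j. \<omega> j < ereal (Re (((\<lambda>k :: nat ^ 'n. \<chi> i. complex_of_real (a $ i + real (k $ i) * b $ i)) \<circ> \<sigma>) m $ j))"
  have \<omega>l: "\<omega> j < ereal (Re (l k $ j))" and zl: "laplace f (l k) = 0" for k j
  proof -
    obtain m where "k = \<sigma> m" using \<sigma> by (metis bij_pointE)
    then show "\<omega> j < ereal (Re (l k $ j))" "laplace f (l k) = 0"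
      using \<omega>[rule_format, where m = m and j = j] zero[rule_format, of m] by (auto simp: l_def)
  qed
  have "\<exists>y::real. \<omega> j < ereal y \<and> y < a $ j" for j
    using ereal_dense2[OF \<omega>l[of j 0]] by (auto simp: l_def)
  then obtain y :: "'n \<Rightarrow> real" where y: "\<And>j. \<omega> j < ereal (y j)" "\<And>j. y j < a $ j" by metis
  define c where "c = (\<chi> j. y j)"
  show "AE t in lebesgue_on {0..}. f t = 0"
  proof (rule AE_eq_0_if_laplace_eq_0[OF f _ b])
    show "c $ i < a $ i" for i using y by (simp add: c_def)
    have "(\<chi> i. complex_of_real (c $ i)) \<in> laplace_bdd_dom f"
      using dom y(1) by (auto simp: c_def)
    then show "bounded (laplace_partial f (\<chi> i. complex_of_real (c $ i)) ` {0..})"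
      by (simp add: laplace_bdd_dom_def)
    fix k :: "nat ^ 'n"
    have "l k \<in> laplace_dom f" using dom \<omega>l by auto
    then obtain L where L: "(laplace_partial f (l k) \<longlongrightarrow> L) at_top"
      by (auto simp: laplace_dom_def)
    then have "laplace f (l k) = L"
      unfolding laplace_def by (intro tendsto_Lim at_top_vec_neq_bot)
    then show "(laplace_partial f (\<chi> i. complex_of_real (a $ i + real (k $ i) * b $ i)) \<longlongrightarrow> 0) at_top"
      using L zl by (simp add: l_def)
  qed
qed

theorem proposition2p3:
  fixes a b :: "real ^ 'n"
  assumes "\<And>i. a $ i > 0" and "\<And>i. b $ i > 0"
  shows "total_in_L1 (lebesgue_on ({0..} :: (real ^ 'n) set))
           (range (\<lambda>(k :: nat ^ 'n) t.
              complex_of_real (exp (- (\<Sum>i\<in>UNIV. (a $ i + real (k $ i) * b $ i) * t $ i))))) \<and>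
         uniqueness_family
           (\<lambda>k :: nat ^ 'n. \<chi> i. complex_of_real (a $ i + real (k $ i) * b $ i))"
  using exponentials_total_in_L1[OF assms] arithmetic_grid_uniqueness_family[OF assms(2)]
  unfolding exponentials_def by (rule conjI)

end
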